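(* Algorithm NG (specified in the context) determines whether a graph $G$ is an NG-graph in polynomial time (polynomial in $n=|V(G)|$).
   Context: Graphs are finite and simple. $\overline{G}$ is the complement of $G$, $\chi$ is the chromatic number, and $G[S]$ is the subgraph of $G$ induced by $S$. A graph $G$ with $n=|V(G)|$ is an NG-graph if $\chi(G)+\chi(\overline{G})=n+1$. Algorithm NG. Input: a graph $G$ with $n=|V(G)|$. Output: a determination of whether $G$ is an NG-graph and, if so, its chromatic number. For $k=1,2,\dots,n$ in turn, do the following. Set $A=\{v:\deg(v)=k-1\}$, $B=\{v:\deg(v)>k-1\}$, $C=\{v:\deg(v)<k-1\}$ and ask: (i) Is $A$ nonempty and is $G[A]$ a complete graph, an independent set, or a 5-cycle? (ii) Is $G[B]$ complete? (iii) Is $G[C]$ an independent set? (iv) Is $ab\in E(G)$ for all $a\in A$, $b\in B$? (v) Is $ac\notin E(G)$ for all $a\in A$, $c\in C$? If all answers are yes, perform check (vi): if $G[A]$ is a complete graph, check that $|A|+|B|=k$; if $G[A]$ is an independent set, check that $|B|+1=k$; if $G[A]$ is a 5-cycle, check that $|B|+3=k$. If (vi) is also affirmative, report that $G$ is an NG-graph with $\chi(G)=k$ and stop. Otherwise (if some answer among (i)-(vi) is no) continue with the next value of $k$. If all values $k=1,\dots,n$ have been tried without success, report that $G$ is not an NG-graph. (The empty graph with $B=\emptyset$ or $C=\emptyset$ counts as a yes in (ii) or (iii).) *)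

theory Defs
  imports "HOL-Library.Ramsey" "HOL-Computational_Algebra.Polynomial"
begin

section \<open>Finite simple graphs\<close>

datatype 'a ugraph = UGraph (verts: "'a set") (edges: "'a set set")

definition simple_graph :: "'a ugraph \<Rightarrow> bool" where
  "simple_graph G \<longleftrightarrow> finite (verts G) \<and> edges G \<subseteq> nsets (verts G) 2"

definition complement :: "'a ugraph \<Rightarrow> 'a ugraph" where
  "complement G = UGraph (verts G) (nsets (verts G) 2 - edges G)"

definition induced :: "'a ugraph \<Rightarrow> 'a set \<Rightarrow> 'a ugraph" where
  "induced G S = UGraph S {e \<in> edges G. e \<subseteq> S}"

definition vertex_degree :: "'a ugraph \<Rightarrow> 'a \<Rightarrow> nat" where
  "vertex_degree G v = card {u \<in> verts G. {v, u} \<in> edges G}"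

definition colorable :: "'a ugraph \<Rightarrow> nat \<Rightarrow> bool" where
  "colorable G k \<longleftrightarrow>
     (\<exists>c :: 'a \<Rightarrow> nat. (\<forall>v \<in> verts G. c v < k) \<and>
        (\<forall>u \<in> verts G. \<forall>v \<in> verts G. {u, v} \<in> edges G \<longrightarrow> c u \<noteq> c v))"

definition chromatic_number :: "'a ugraph \<Rightarrow> nat" where
  "chromatic_number G = (LEAST k. colorable G k)"

definition NG_graph :: "'a ugraph \<Rightarrow> bool" where
  "NG_graph G \<longleftrightarrow>
     chromatic_number G + chromatic_number (complement G) = card (verts G) + 1"

definition complete_graph :: "'a ugraph \<Rightarrow> bool" where
  "complete_graph G \<longleftrightarrow> clique (verts G) (edges G)"

definition independent_graph :: "'a ugraph \<Rightarrow> bool" where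
  "independent_graph G \<longleftrightarrow> indep (verts G) (edges G)"

definition five_cycle :: "'a ugraph \<Rightarrow> bool" where
  "five_cycle G \<longleftrightarrow>
     (\<exists>a b c d e. distinct [a, b, c, d, e] \<and> verts G = {a, b, c, d, e} \<and>
        edges G = {{a, b}, {b, c}, {c, d}, {d, e}, {e, a}})"


section \<open>Algorithm NG\<close>

text \<open>The questions (i)--(v) and the check (vi) for one value of \<open>k\<close>. A single vertex is
  at once complete and independent; the two size checks then coincide.\<close>

definition NG_check :: "'a ugraph \<Rightarrow> nat \<Rightarrow> bool" where
  "NG_check G k \<longleftrightarrow>
    (let A = {v \<in> verts G. vertex_degree G v = k - 1};
         B = {v \<in> verts G. vertex_degree G v > k - 1};
         C = {v \<in> verts G. vertex_degree G v < k - 1}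
     in A \<noteq> {} \<and>
        (complete_graph (induced G A) \<or> independent_graph (induced G A)
          \<or> five_cycle (induced G A)) \<and>
        complete_graph (induced G B) \<and>
        independent_graph (induced G C) \<and>
        (\<forall>a \<in> A. \<forall>b \<in> B. {a, b} \<in> edges G) \<and>
        (\<forall>a \<in> A. \<forall>c \<in> C. {a, c} \<notin> edges G) \<and>
        (complete_graph (induced G A) \<longrightarrow> card A + card B = k) \<and>
        (independent_graph (induced G A) \<longrightarrow> card B + 1 = k) \<and>
        (five_cycle (induced G A) \<longrightarrow> card B + 3 = k))"

text \<open>The outcome \<open>Some k\<close> is the report ``NG-graph with chromatic number \<open>k\<close>'', and \<open>None\<close>
  the report ``not an NG-graph''. The function \<^const>\<open>find\<close> returns the first success.\<close>

definition algorithm_NG :: "'a ugraph \<Rightarrow> nat option" where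
  "algorithm_NG G = find (NG_check G) [1..<Suc (card (verts G))]"


section \<open>A machine model with running times\<close>

text \<open>While programs over registers and one-dimensional arrays of natural numbers, with
  read-only access to the adjacency matrix of the input graph. Every operation costs one unit.
  The only arithmetic is addition and truncated subtraction: there is no multiplication, so
  the bit length of a number grows by at most one per step (beyond the constants of the program)
  and polynomial unit-cost time is polynomial time on a Turing machine.\<close>

datatype 'v aexp =
    Num nat
  | Reg 'v
  | Load 'v "'v aexp"
  | Plus "'v aexp" "'v aexp"
  | Minus "'v aexp" "'v aexp"

datatype 'v bexp =
    Adj "'v aexp" "'v aexp"
  | Less "'v aexp" "'v aexp"
  | Eq "'v aexp" "'v aexp"
  | Neg "'v bexp"
  | Conj "'v bexp" "'v bexp"

datatype 'v com =
    Skip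
  | Assign 'v "'v aexp" (infix \<open>::=\<close> 63)
  | Store 'v "'v aexp" "'v aexp"
  | Seq "'v com" "'v com" (infixr \<open>;;\<close> 61)
  | Cond "'v bexp" "'v com" "'v com"
  | While "'v bexp" "'v com"

text \<open>The contents of the registers and of the arrays.\<close>

type_synonym 'v state = "('v \<Rightarrow> nat) \<times> ('v \<Rightarrow> nat \<Rightarrow> nat)"

type_synonym matrix = "nat \<Rightarrow> nat \<Rightarrow> bool"

primrec aval :: "'v aexp \<Rightarrow> 'v state \<Rightarrow> nat" where
  "aval (Num n) s = n"
| "aval (Reg x) s = fst s x"
| "aval (Load x e) s = snd s x (aval e s)"
| "aval (Plus e1 e2) s = aval e1 s + aval e2 s"
| "aval (Minus e1 e2) s = aval e1 s - aval e2 s"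

primrec bval :: "matrix \<Rightarrow> 'v bexp \<Rightarrow> 'v state \<Rightarrow> bool" where
  "bval M (Adj e1 e2) s = M (aval e1 s) (aval e2 s)"
| "bval M (Less e1 e2) s = (aval e1 s < aval e2 s)"
| "bval M (Eq e1 e2) s = (aval e1 s = aval e2 s)"
| "bval M (Neg b) s = (\<not> bval M b s)"
| "bval M (Conj b1 b2) s = (bval M b1 s \<and> bval M b2 s)"

primrec acost :: "'v aexp \<Rightarrow> nat" where
  "acost (Num n) = 1"
| "acost (Reg x) = 1"
| "acost (Load x e) = 1 + acost e"
| "acost (Plus e1 e2) = 1 + acost e1 + acost e2"
| "acost (Minus e1 e2) = 1 + acost e1 + acost e2"

primrec bcost :: "'v bexp \<Rightarrow> nat" where
  "bcost (Adj e1 e2) = 1 + acost e1 + acost e2"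
| "bcost (Less e1 e2) = 1 + acost e1 + acost e2"
| "bcost (Eq e1 e2) = 1 + acost e1 + acost e2"
| "bcost (Neg b) = 1 + bcost b"
| "bcost (Conj b1 b2) = 1 + bcost b1 + bcost b2"

text \<open>\<open>run M c s t s'\<close>: with input matrix \<open>M\<close>, the program \<open>c\<close> started in state \<open>s\<close> halts after
  \<open>t\<close> units of time in state \<open>s'\<close>.\<close>

inductive run :: "matrix \<Rightarrow> 'v com \<Rightarrow> 'v state \<Rightarrow> nat \<Rightarrow> 'v state \<Rightarrow> bool" for M where
  run_Skip: "run M Skip s 1 s"
| run_Assign:
    "run M (x ::= e) s (1 + acost e) ((fst s)(x := aval e s), snd s)"
| run_Store:
    "run M (Store x i e) s (1 + acost i + acost e)
       (fst s, (snd s)(x := (snd s x)(aval i s := aval e s)))"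
| run_Seq:
    "\<lbrakk>run M c1 s t1 s'; run M c2 s' t2 s''\<rbrakk> \<Longrightarrow> run M (c1 ;; c2) s (t1 + t2) s''"
| run_Cond_True:
    "\<lbrakk>bval M b s; run M c1 s t s'\<rbrakk> \<Longrightarrow> run M (Cond b c1 c2) s (1 + bcost b + t) s'"
| run_Cond_False:
    "\<lbrakk>\<not> bval M b s; run M c2 s t s'\<rbrakk> \<Longrightarrow> run M (Cond b c1 c2) s (1 + bcost b + t) s'"
| run_While_False:
    "\<not> bval M b s \<Longrightarrow> run M (While b c) s (1 + bcost b) s"
| run_While_True:
    "\<lbrakk>bval M b s; run M c s t1 s'; run M (While b c) s' t2 s''\<rbrakk>
       \<Longrightarrow> run M (While b c) s (1 + bcost b + t1 + t2) s''"

inductive_cases run_SkipE: "run M Skip s t s'"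
inductive_cases run_AssignE: "run M (x ::= e) s t s'"
inductive_cases run_StoreE: "run M (Store x i e) s t s'"
inductive_cases run_SeqE: "run M (c1 ;; c2) s t s'"
inductive_cases run_CondE: "run M (Cond b c1 c2) s t s'"
inductive_cases run_WhileE: "run M (While b c) s t s'"

text \<open>Programs are deterministic: the halting time and the final state are unique.\<close>

lemma run_deterministic:
  "run M c s t s' \<Longrightarrow> run M c s u s'' \<Longrightarrow> u = t \<and> s'' = s'"
proof (induction arbitrary: u s'' rule: run.induct)
  case (run_Skip s)
  then show ?case by (rule run_SkipE) simp
next
  case (run_Assign x e s)
  then show ?case by (rule run_AssignE) simp
next
  case (run_Store x i e s)
  then show ?case by (rule run_StoreE) simp
next
  case (run_Seq c1 s t1 s1 c2 t2 s2)
  from run_Seq.prems show ?case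
  proof (rule run_SeqE)
    fix t1' s1' t2'
    assume u: "u = t1' + t2'" and r1: "run M c1 s t1' s1'" and r2: "run M c2 s1' t2' s''"
    have 1: "t1' = t1" "s1' = s1" using run_Seq.IH(1)[OF r1] by simp_all
    have "t2' = t2" "s'' = s2" using run_Seq.IH(2)[OF r2[unfolded 1]] by simp_all
    with u 1 show ?thesis by simp
  qed
next
  case (run_Cond_True b s c1 t s1 c2)
  from run_Cond_True.prems show ?case
  proof (rule run_CondE)
    fix t'
    assume u: "u = Suc (bcost b + t')" and r: "run M c1 s t' s''"
    show ?thesis using run_Cond_True.IH[OF r] u by simp
  qed (simp add: run_Cond_True.hyps)
next
  case (run_Cond_False b s c2 t s1 c1)
  from run_Cond_False.prems show ?case
  proof (rule run_CondE)
    fix t'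
    assume u: "u = Suc (bcost b + t')" and r: "run M c2 s t' s''"
    show ?thesis using run_Cond_False.IH[OF r] u by simp
  qed (simp add: run_Cond_False.hyps)
next
  case (run_While_False b s c)
  from run_While_False.prems show ?case
    by (rule run_WhileE) (simp_all add: run_While_False.hyps)
next
  case (run_While_True b s c t1 s1 t2 s2)
  from run_While_True.prems show ?case
  proof (rule run_WhileE)
    fix t1' s1' t2'
    assume u: "u = Suc (bcost b + t1' + t2')"
      and r1: "run M c s t1' s1'" and r2: "run M (While b c) s1' t2' s''"
    have 1: "t1' = t1" "s1' = s1" using run_While_True.IH(1)[OF r1] by simp_all
    have "t2' = t2" "s'' = s2" using run_While_True.IH(2)[OF r2[unfolded 1]] by simp_all
    with u 1 show ?thesis by simp
  qed (simp add: run_While_True.hyps)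
qed

abbreviation (input) Disj :: "'v bexp \<Rightarrow> 'v bexp \<Rightarrow> 'v bexp" where
  "Disj b1 b2 \<equiv> Neg (Conj (Neg b1) (Neg b2))"

abbreviation (input) Imp :: "'v bexp \<Rightarrow> 'v bexp \<Rightarrow> 'v bexp" where
  "Imp b1 b2 \<equiv> Neg (Conj b1 (Neg b2))"

abbreviation (input) When :: "'v bexp \<Rightarrow> 'v com \<Rightarrow> 'v com" where
  "When b c \<equiv> Cond b c Skip"

text \<open>\<open>for x = 0, \<dots>, e - 1 do c\<close>\<close>

definition For :: "'v \<Rightarrow> 'v aexp \<Rightarrow> 'v com \<Rightarrow> 'v com" where
  "For x e c = (x ::= Num 0 ;; While (Less (Reg x) e) (c ;; x ::= Plus (Reg x) (Num 1)))"


section \<open>Algorithm NG as a program\<close>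

text \<open>Vertices are the numbers below the content of \<open>Xn\<close>. The array \<open>Xdeg\<close> holds the degrees;
  \<open>Xa\<close> and \<open>Xb\<close> hold \<open>|A|\<close> and \<open>|B|\<close>, and \<open>Xnb\<close> the number of neighbours of \<open>u \<in> A\<close> within \<open>A\<close>.
  The remaining registers are truth values: whether \<open>G[A]\<close> is complete (\<open>XcomplA\<close>), independent
  (\<open>XindepA\<close>), 2-regular (\<open>XregA\<close>), whether \<open>G[B]\<close> is complete (\<open>XcomplB\<close>), \<open>G[C]\<close> is independent
  (\<open>XindepC\<close>), all (\<open>XallAB\<close>) or no (\<open>XnoneAC\<close>) pairs between the two sets are adjacent, and
  whether a success has been reported (\<open>Xfound\<close>).\<close>

datatype reg =
    Xn | Xk | Xu | Xv | Xdeg | Xa | Xb | Xnb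
  | XcomplA | XindepA | XregA | XcomplB | XindepC | XallAB | XnoneAC | Xfound

definition in_A :: "reg \<Rightarrow> reg bexp" where
  "in_A x = Eq (Load Xdeg (Reg x)) (Minus (Reg Xk) (Num 1))"

definition in_B :: "reg \<Rightarrow> reg bexp" where
  "in_B x = Less (Minus (Reg Xk) (Num 1)) (Load Xdeg (Reg x))"

definition in_C :: "reg \<Rightarrow> reg bexp" where
  "in_C x = Less (Load Xdeg (Reg x)) (Minus (Reg Xk) (Num 1))"

abbreviation (input) yes :: "reg \<Rightarrow> reg bexp" where
  "yes x \<equiv> Eq (Reg x) (Num 1)"

definition compute_degrees :: "reg com" where
  "compute_degrees =
     For Xu (Reg Xn)
       (Store Xdeg (Reg Xu) (Num 0) ;;
        For Xv (Reg Xn)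
          (When (Adj (Reg Xu) (Reg Xv))
             (Store Xdeg (Reg Xu) (Plus (Load Xdeg (Reg Xu)) (Num 1)))))"

definition inspect_pair :: "reg com" where
  "inspect_pair =
     Cond (Adj (Reg Xu) (Reg Xv))
       (When (Conj (in_A Xu) (in_A Xv)) (XindepA ::= Num 0 ;; Xnb ::= Plus (Reg Xnb) (Num 1)) ;;
        When (Conj (in_C Xu) (in_C Xv)) (XindepC ::= Num 0) ;;
        When (Conj (in_A Xu) (in_C Xv)) (XnoneAC ::= Num 0))
       (When (Neg (Eq (Reg Xu) (Reg Xv)))
         (When (Conj (in_A Xu) (in_A Xv)) (XcomplA ::= Num 0) ;;
          When (Conj (in_B Xu) (in_B Xv)) (XcomplB ::= Num 0) ;;
          When (Conj (in_A Xu) (in_B Xv)) (XallAB ::= Num 0)))"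

definition inspect_partition :: "reg com" where
  "inspect_partition =
     Xa ::= Num 0 ;; Xb ::= Num 0 ;;
     XcomplA ::= Num 1 ;; XindepA ::= Num 1 ;; XregA ::= Num 1 ;;
     XcomplB ::= Num 1 ;; XindepC ::= Num 1 ;; XallAB ::= Num 1 ;; XnoneAC ::= Num 1 ;;
     For Xu (Reg Xn)
       (When (in_A Xu) (Xa ::= Plus (Reg Xa) (Num 1)) ;;
        When (in_B Xu) (Xb ::= Plus (Reg Xb) (Num 1)) ;;
        Xnb ::= Num 0 ;;
        For Xv (Reg Xn) inspect_pair ;;
        When (Conj (in_A Xu) (Neg (Eq (Reg Xnb) (Num 2)))) (XregA ::= Num 0))"

text \<open>A 2-regular simple graph on five vertices is a 5-cycle.\<close>

definition five_cycle_A :: "reg bexp" where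
  "five_cycle_A = Conj (yes XregA) (Eq (Reg Xa) (Num 5))"

definition all_answers_yes :: "reg bexp" where
  "all_answers_yes =
     Conj (Less (Num 0) (Reg Xa))
    (Conj (Disj (yes XcomplA) (Disj (yes XindepA) five_cycle_A))
    (Conj (yes XcomplB)
    (Conj (yes XindepC)
    (Conj (yes XallAB)
    (Conj (yes XnoneAC)
    (Conj (Imp (yes XcomplA) (Eq (Plus (Reg Xa) (Reg Xb)) (Reg Xk)))
    (Conj (Imp (yes XindepA) (Eq (Plus (Reg Xb) (Num 1)) (Reg Xk)))
          (Imp five_cycle_A (Eq (Plus (Reg Xb) (Num 3)) (Reg Xk))))))))))"

definition NG_program :: "reg com" where
  "NG_program =
     compute_degrees ;;
     Xfound ::= Num 0 ;;
     Xk ::= Num 1 ;;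
     While (Conj (Eq (Reg Xfound) (Num 0)) (Neg (Less (Reg Xn) (Reg Xk))))
       (inspect_partition ;;
        Cond all_answers_yes (Xfound ::= Num 1) (Xk ::= Plus (Reg Xk) (Num 1)))"

text \<open>The input is the adjacency matrix with respect to an enumeration \<open>vs\<close> of the vertices,
  together with the number of vertices in \<open>Xn\<close>.\<close>

definition adjacency_matrix :: "'a ugraph \<Rightarrow> 'a list \<Rightarrow> matrix" where
  "adjacency_matrix G vs i j \<longleftrightarrow>
     i < length vs \<and> j < length vs \<and> {vs ! i, vs ! j} \<in> edges G"

definition initial_state :: "nat \<Rightarrow> reg state" where
  "initial_state n = ((\<lambda>_. 0)(Xn := n), \<lambda>_ _. 0)"

definition report :: "reg state \<Rightarrow> nat option" where
  "report s = (if fst s Xfound = 1 then Some (fst s Xk) else None)"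

end

theory Submission
  imports Defs
begin

text \<open>A graph is treated as a symmetric irreflexive relation \<open>E\<close> on a finite set \<open>V\<close>. Its complement
\<open>co E\<close> is again such a relation, so every statement about \<open>E\<close> can be read for the complement, and
the roles of high and low degree, or of cliques and independent sets, are interchangeable.

Let \<open>k = \<chi>(G)\<close> and \<open>l = \<chi>(co G)\<close> with \<open>k + l = n + 1\<close>. Take \<open>S\<close> minimal with \<open>\<chi>(G[S]) = k\<close> and \<open>T\<close>
minimal with \<open>\<chi>(co G[T]) = l\<close>. By minimality the vertices of \<open>S\<close> have degree at least \<open>k - 1\<close>
in \<open>G[S]\<close>, and those of \<open>T\<close> have degree at least \<open>l - 1\<close> in \<open>co G[T]\<close>. The degrees of a vertex in \<open>G\<close>
and in \<open>co G\<close> add up to \<open>n - 1 = (k - 1) + (l - 1)\<close>.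
Hence a vertex of \<open>A\<^sub>0 = S \<inter> T\<close> has all its neighbours in \<open>S\<close> and all its non-neighbours in \<open>T\<close>: it is
adjacent to all of \<open>B\<^sub>0 = S - T\<close> and to nothing in \<open>C\<^sub>0 = T - S\<close>. Counting shows \<open>A\<^sub>0 \<noteq> {}\<close>.
Subadditivity of \<open>\<chi>\<close> and the inequality of Nordhaus and Gaddum for \<open>A\<^sub>0\<close> leave no slack, so \<open>B\<^sub>0\<close> is
a clique, \<open>C\<^sub>0\<close> is independent, and \<open>G[A\<^sub>0]\<close> is itself an NG-graph, which is moreover regular
(\<open>extremal_parts_exist\<close>).

A \<open>d\<close>-regular graph on \<open>d + e + 1\<close> vertices with \<open>\<chi> = d + 1\<close> and \<open>\<chi> = e + 1\<close> for the complement is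
complete, independent or a 5-cycle (\<open>regular_extremal_shape\<close>). Matchings prove this. A colouring of
the complement is a partition into cliques, so no such partition saves more than \<open>d\<close> against the
partition into single vertices, whereas a matching with \<open>d\<close> edges saves exactly \<open>d\<close>. A matching that
attains the bound is optimal on every set of vertices that it respects, and this excludes one
local configuration after the other.

The class of vertices of degree \<open>k - 1\<close> can be larger than \<open>A\<^sub>0\<close>. A vertex of \<open>B\<^sub>0\<close> in this class forces
\<open>A\<^sub>0\<close> to be a clique and has no neighbour in \<open>C\<^sub>0\<close>, so it can be moved into \<open>A\<^sub>0\<close>; dually for \<open>C\<^sub>0\<close>; and
the two cannot occur together (\<open>NG_partition_by_degree\<close>). Conversely, a partition with the required
adjacencies gives \<open>\<chi>(G) = |B| + \<chi>(G[A])\<close> and \<open>\<chi>(co G) = |C| + \<chi>(co G[A])\<close>, so \<open>G\<close> is an NG-graph and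
check (vi) just says that \<open>k\<close> is the chromatic number. Thus the check for \<open>k\<close> succeeds exactly if \<open>G\<close> is
an NG-graph and \<open>k = \<chi>(G)\<close> (\<open>NG_check_iff\<close>), so the first success is the only one.

The program is analysed with a total-correctness judgement that carries a time bound. Its nested
loops run at most \<open>n\<close> times each, and the truth values that it maintains are conjunctions over the
pairs of vertices scanned so far (\<open>halts_inspect_partition\<close>, \<open>halts_search\<close>).\<close>

section \<open>Chromatic numbers of adjacency relations\<close>

definition co :: "('a \<Rightarrow> 'a \<Rightarrow> bool) \<Rightarrow> 'a \<Rightarrow> 'a \<Rightarrow> bool" where
  "co E u v \<longleftrightarrow> u \<noteq> v \<and> \<not> E u v"

definition proper :: "('a \<Rightarrow> 'a \<Rightarrow> bool) \<Rightarrow> 'a set \<Rightarrow> ('a \<Rightarrow> 'b) \<Rightarrow> bool" where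
  "proper E V c \<longleftrightarrow> (\<forall>u\<in>V. \<forall>v\<in>V. E u v \<longrightarrow> c u \<noteq> c v)"

text \<open>A chromatic number relative to a relation and a vertex set, so that induced subgraphs and
complements need no graph constructor.\<close>

definition chi :: "('a \<Rightarrow> 'a \<Rightarrow> bool) \<Rightarrow> 'a set \<Rightarrow> nat" where
  "chi E V = (LEAST k. \<exists>c :: 'a \<Rightarrow> nat. proper E V c \<and> c ` V \<subseteq> {..<k})"

definition nbrs :: "('a \<Rightarrow> 'a \<Rightarrow> bool) \<Rightarrow> 'a set \<Rightarrow> 'a \<Rightarrow> 'a set" where
  "nbrs E V v = {u \<in> V. E v u}"

abbreviation deg :: "('a \<Rightarrow> 'a \<Rightarrow> bool) \<Rightarrow> 'a set \<Rightarrow> 'a \<Rightarrow> nat" where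
  "deg E V v \<equiv> card (nbrs E V v)"

definition clique_on :: "('a \<Rightarrow> 'a \<Rightarrow> bool) \<Rightarrow> 'a set \<Rightarrow> bool" where
  "clique_on E K \<longleftrightarrow> (\<forall>u\<in>K. \<forall>v\<in>K. u \<noteq> v \<longrightarrow> E u v)"

text \<open>The colours may come from any type; disjoint palettes are then sums of types and
partitions into classes are colourings by sets.\<close>

lemma chi_le_card_colours:
  assumes "proper E V c" "finite S" "c ` V \<subseteq> S"
  shows "chi E V \<le> card S"
proof -
  obtain h where h: "bij_betw h S {0..<card S}"
    using ex_bij_betw_finite_nat[OF assms(2)] by blast
  have inj: "h a = h b \<longleftrightarrow> a = b" if "a \<in> S" "b \<in> S" for a b
    using bij_betw_imp_inj_on[OF h] that by (simp add: inj_on_eq_iff)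
  have cS: "c v \<in> S" if "v \<in> V" for v using assms(3) that by blast
  have "proper E V (h \<circ> c)"
    using assms(1) cS unfolding proper_def by (simp add: inj)
  moreover have "(h \<circ> c) ` V \<subseteq> {..<card S}"
    using assms(3) bij_betw_imp_surj_on[OF h] by fastforce
  ultimately show ?thesis unfolding chi_def by (intro Least_le) blast
qed

lemma finite_nbrs: "finite V \<Longrightarrow> finite (nbrs E V v)"
  by (simp add: nbrs_def)

locale adjacency =
  fixes E :: "'a \<Rightarrow> 'a \<Rightarrow> bool"
  assumes sym: "E u v \<Longrightarrow> E v u" and irrefl: "\<not> E v v"
begin

lemma adjacency_co: "adjacency (co E)"
  by unfold_locales (auto simp: co_def dest: sym)

lemma co_co: "co (co E) = E"
  by (intro ext) (auto simp: co_def irrefl)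

lemma chi_colouring:
  assumes "finite V"
  obtains c :: "'a \<Rightarrow> nat" where "proper E V c" "c ` V \<subseteq> {..<chi E V}"
proof -
  obtain h where h: "bij_betw h V {0..<card V}"
    using ex_bij_betw_finite_nat[OF assms] by blast
  have "proper E V h"
    using bij_betw_imp_inj_on[OF h] unfolding proper_def inj_on_def by (metis irrefl)
  moreover have "h ` V \<subseteq> {..<card V}"
    using bij_betw_imp_surj_on[OF h] by fastforce
  ultimately have "\<exists>k. \<exists>c :: 'a \<Rightarrow> nat. proper E V c \<and> c ` V \<subseteq> {..<k}" by blast
  from LeastI_ex[OF this] show ?thesis using that unfolding chi_def by blast
qed

lemma chi_mono:
  assumes "finite V" "S \<subseteq> V"
  shows "chi E S \<le> chi E V"
proof -
  obtain c :: "'a \<Rightarrow> nat" where "proper E V c" "c ` V \<subseteq> {..<chi E V}"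
    using chi_colouring[OF assms(1)] .
  then have "proper E S c" "c ` S \<subseteq> {..<chi E V}"
    using assms(2) unfolding proper_def by blast+
  from chi_le_card_colours[OF this(1) _ this(2)] show ?thesis by simp
qed

text \<open>Use disjoint palettes on the two sets.\<close>

lemma chi_Un_le:
  assumes "finite A" "finite B"
  shows "chi E (A \<union> B) \<le> chi E A + chi E B"
proof -
  obtain a :: "'a \<Rightarrow> nat" where a: "proper E A a" "a ` A \<subseteq> {..<chi E A}"
    using chi_colouring[OF assms(1)] .
  obtain b :: "'a \<Rightarrow> nat" where b: "proper E B b" "b ` B \<subseteq> {..<chi E B}"
    using chi_colouring[OF assms(2)] .
  let ?c = "\<lambda>v. if v \<in> A then Inl (a v) else Inr (b v)"
  have "proper E (A \<union> B) ?c" using a(1) b(1) by (auto simp: proper_def)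
  moreover have "?c ` (A \<union> B) \<subseteq> {..<chi E A} <+> {..<chi E B}" using a(2) b(2) by auto
  ultimately have "chi E (A \<union> B) \<le> card ({..<chi E A} <+> {..<chi E B})"
    by (intro chi_le_card_colours[where c = ?c] finite_Plus finite_lessThan)
  then show ?thesis by (simp add: card_Plus)
qed

text \<open>Across a complete join no colour can be shared.\<close>

lemma chi_join:
  assumes "finite A" "finite B" and join: "\<And>a b. a \<in> A \<Longrightarrow> b \<in> B \<Longrightarrow> E a b"
  shows "chi E (A \<union> B) = chi E A + chi E B"
proof (rule antisym[OF chi_Un_le[OF assms(1,2)]])
  obtain c :: "'a \<Rightarrow> nat" where c: "proper E (A \<union> B) c" "c ` (A \<union> B) \<subseteq> {..<chi E (A \<union> B)}"
    using chi_colouring[of "A \<union> B"] assms by auto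
  have "chi E A \<le> card (c ` A)" "chi E B \<le> card (c ` B)"
    using c(1) assms(1,2) by (auto intro!: chi_le_card_colours simp: proper_def)
  moreover have "c ` A \<inter> c ` B = {}" using c(1) join unfolding proper_def by blast
  then have "card (c ` A) + card (c ` B) = card (c ` (A \<union> B))"
    using assms(1,2) by (simp add: image_Un card_Un_disjoint)
  moreover have "card (c ` (A \<union> B)) \<le> chi E (A \<union> B)"
    using card_mono[OF _ c(2)] by simp
  ultimately show "chi E A + chi E B \<le> chi E (A \<union> B)" by linarith
qed

lemma chi_le_card: "finite V \<Longrightarrow> chi E V \<le> card V"
  using chi_le_card_colours[of E V "\<lambda>v. v" V] by (metis proper_def irrefl image_ident order_refl)

lemma chi_clique:
  assumes "finite K" "clique_on E K"
  shows "chi E K = card K"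
proof (rule antisym[OF chi_le_card[OF assms(1)]])
  obtain c :: "'a \<Rightarrow> nat" where c: "proper E K c" "c ` K \<subseteq> {..<chi E K}"
    using chi_colouring[OF assms(1)] .
  have "inj_on c K" using c(1) assms(2) unfolding proper_def clique_on_def inj_on_def by blast
  then show "card K \<le> chi E K" using card_mono[OF _ c(2)] by (simp add: card_image)
qed

text \<open>Two distinct non-adjacent vertices could share a colour.\<close>

lemma chi_eq_card_imp_clique:
  assumes "finite V" "chi E V = card V"
  shows "clique_on E V"
proof (rule ccontr)
  assume "\<not> clique_on E V"
  then obtain x y where xy: "x \<in> V" "y \<in> V" "x \<noteq> y" "\<not> E x y"
    unfolding clique_on_def by blast
  \<comment> \<open>Colour every vertex by itself, except that \<open>x\<close> gets the colour of \<open>y\<close>.\<close>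
  have "proper E V (id(x := y))" using xy by (auto simp: proper_def irrefl dest: sym)
  then have "chi E V \<le> card (V - {x})"
    by (rule chi_le_card_colours) (use xy assms in auto)
  then show False using assms xy card_Diff1_less[of V x] by simp
qed

lemma chi_independent_le:
  assumes "clique_on (co E) K"
  shows "chi E K \<le> 1"
proof -
  have "proper E K (\<lambda>_. ())"
    unfolding proper_def
  proof (intro ballI impI)
    fix u v assume "u \<in> K" "v \<in> K" "E u v"
    then show "() \<noteq> ()" using assms irrefl[of u] by (cases "u = v") (auto simp: clique_on_def co_def)
  qed
  then have "chi E K \<le> card {()}"
    by (rule chi_le_card_colours[where c = "\<lambda>_. ()"]) (rule finite.intros | blast)+
  then show ?thesis by simp
qed

lemma chi_pos:
  assumes "finite V" "V \<noteq> {}"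
  shows "0 < chi E V"
proof -
  obtain c :: "'a \<Rightarrow> nat" where "c ` V \<subseteq> {..<chi E V}" using chi_colouring[OF assms(1)] .
  then show ?thesis using assms(2) by (cases "chi E V") auto
qed

text \<open>Some colour is missing from the neighbourhood of the new vertex.\<close>

lemma chi_insert_low_degree:
  assumes "finite V" "deg E V v < j" "chi E V \<le> j"
  shows "chi E (insert v V) \<le> j"
proof -
  obtain c :: "'a \<Rightarrow> nat" where c: "proper E V c" "c ` V \<subseteq> {..<chi E V}"
    using chi_colouring[OF assms(1)] .
  have "card (c ` nbrs E V v) < card {..<j}"
    using card_image_le[OF finite_nbrs[OF assms(1)], of c E v] assms(2) by simp
  then obtain i where i: "i < j" "i \<notin> c ` nbrs E V v"
    by (metis card_mono finite_imageI finite_nbrs assms(1) lessThan_iff not_less subsetI)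
  let ?c = "c(v := i)"
  have "proper E (insert v V) ?c"
    using c(1) i(2) irrefl unfolding proper_def nbrs_def
    by (auto simp: image_iff dest: sym)
  then show ?thesis
    using chi_le_card_colours[of E "insert v V" ?c "{..<j}"] c(2) i(1) assms(3) by fastforce
qed

text \<open>In a smallest subset with the full chromatic number no vertex can be added back greedily.\<close>

lemma critical_subset:
  assumes "finite V"
  obtains S where "S \<subseteq> V" "chi E S = chi E V" "\<And>v. v \<in> S \<Longrightarrow> chi E V \<le> Suc (deg E S v)"
proof -
  define P where "P S \<longleftrightarrow> S \<subseteq> V \<and> chi E S = chi E V" for S
  have "P V" by (simp add: P_def)
  then obtain S where "P S" and min: "\<And>T. P T \<Longrightarrow> card S \<le> card T"
    using ex_has_least_nat[of P V card] by blast
  then have S: "S \<subseteq> V" "chi E S = chi E V" by (simp_all add: P_def)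
  have fin: "finite S" using S(1) assms finite_subset by blast
  have "chi E V \<le> Suc (deg E S v)" if "v \<in> S" for v
  proof (rule ccontr)
    assume low: "\<not> ?thesis"
    have "card (S - {v}) < card S" using fin that by (rule card_Diff1_less)
    then have "chi E (S - {v}) \<noteq> chi E V" using min[of "S - {v}"] S(1) by (auto simp: P_def)
    moreover have "chi E (S - {v}) \<le> chi E V" using chi_mono[of S "S - {v}"] fin S(2) by auto
    ultimately have lt: "chi E (S - {v}) \<le> chi E V - 1" by linarith
    have "nbrs E (S - {v}) v = nbrs E S v" by (auto simp: nbrs_def irrefl)
    then have "deg E (S - {v}) v < chi E V - 1" using low by simp
    from chi_insert_low_degree[OF _ this lt] have "chi E S \<le> chi E V - 1"
      using fin that by (simp add: insert_absorb)
    then show False using S(2) low by simp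
  qed
  then show ?thesis using that S by blast
qed

lemma deg_co:
  assumes "finite V" "v \<in> V"
  shows "Suc (deg E V v + deg (co E) V v) = card V"
proof -
  have V: "V = insert v (nbrs E V v \<union> nbrs (co E) V v)"
    using assms by (auto simp: nbrs_def co_def)
  have "v \<notin> nbrs E V v \<union> nbrs (co E) V v" "nbrs E V v \<inter> nbrs (co E) V v = {}"
    by (auto simp: nbrs_def co_def irrefl)
  then have "card (insert v (nbrs E V v \<union> nbrs (co E) V v)) = Suc (deg E V v + deg (co E) V v)"
    using assms(1) by (simp add: finite_nbrs card_Un_disjoint)
  then show ?thesis using V by simp
qed

lemma deg_mono: "finite V \<Longrightarrow> S \<subseteq> V \<Longrightarrow> deg E S v \<le> deg E V v"
  by (rule card_mono) (auto simp: nbrs_def)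

text \<open>Either the two critical subsets are disjoint, and their sizes bound the sum, or a common vertex has
large degree in both the graph and its complement, whose degrees add up to \<open>|V| - 1\<close>.\<close>

theorem nordhaus_gaddum:
  assumes "finite V"
  shows "chi E V + chi (co E) V \<le> Suc (card V)"
proof -
  interpret co: adjacency "co E" by (rule adjacency_co)
  obtain S where S: "S \<subseteq> V" "chi E S = chi E V" "\<And>v. v \<in> S \<Longrightarrow> chi E V \<le> Suc (deg E S v)"
    using critical_subset[OF assms] by blast
  obtain T where T: "T \<subseteq> V" "chi (co E) T = chi (co E) V"
    "\<And>v. v \<in> T \<Longrightarrow> chi (co E) V \<le> Suc (deg (co E) T v)"
    using co.critical_subset[OF assms] by blast
  have fin: "finite S" "finite T" using S(1) T(1) assms finite_subset by blast+
  show ?thesis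
  proof (cases "S \<inter> T = {}")
    case True
    have "card S + card T = card (S \<union> T)" using True fin by (simp add: card_Un_disjoint)
    also have "\<dots> \<le> card V" using S(1) T(1) assms by (intro card_mono) auto
    finally show ?thesis
      using chi_le_card[OF fin(1)] co.chi_le_card[OF fin(2)] S(2) T(2) by linarith
  next
    case False
    then obtain v where v: "v \<in> S" "v \<in> T" by blast
    show ?thesis
      using S(3)[OF v(1)] T(3)[OF v(2)] deg_mono[OF assms S(1), of v]
        co.deg_mono[OF assms T(1), of v] deg_co[OF assms subsetD[OF S(1) v(1)]] by linarith
  qed
qed

end


section \<open>Matchings and clique covers\<close>

text \<open>A matching is encoded as the involution that swaps matched vertices and fixes the unmatched ones.
Exchanging matching edges then becomes function update.\<close>

definition matching :: "('a \<Rightarrow> 'a \<Rightarrow> bool) \<Rightarrow> 'a set \<Rightarrow> ('a \<Rightarrow> 'a) \<Rightarrow> bool" where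
  "matching E V f \<longleftrightarrow> (\<forall>v\<in>V. f v \<in> V \<and> f (f v) = v \<and> (f v \<noteq> v \<longrightarrow> E v (f v)))"

definition unmatched :: "'a set \<Rightarrow> ('a \<Rightarrow> 'a) \<Rightarrow> 'a set" where
  "unmatched V f = {v \<in> V. f v = v}"

lemma matchingD:
  assumes "matching E V f" "v \<in> V"
  shows "f v \<in> V" "f (f v) = v" "f v \<noteq> v \<Longrightarrow> E v (f v)"
  using assms by (auto simp: matching_def)

text \<open>The orbits of an involution have one or two elements.\<close>

lemma card_two_element_fibres:
  assumes "finite W" "\<And>v. v \<in> W \<Longrightarrow> f v \<in> W \<and> f (f v) = v"
  shows "2 * card ((\<lambda>v. {v, f v}) ` W) = card W + card (unmatched W f)"
proof -
  define U where "U = unmatched W f"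
  define C where "C = (\<lambda>v. {v, f v}) ` (W - U)"
  have U: "U \<subseteq> W" by (auto simp: U_def unmatched_def)
  have moved: "f v \<in> W - U" if "v \<in> W - U" for v
    using assms(2)[of v] that by (auto simp: U_def unmatched_def)
  have "2 * card C = card (\<Union>C)"
  proof (rule card_partition)
    show "finite C" "finite (\<Union>C)" using assms(1) by (auto simp: C_def)
    show "card c = 2" if cC: "c \<in> C" for c
    proof -
      obtain v where "c = {v, f v}" "f v \<noteq> v"
        using cC unfolding C_def U_def unmatched_def by blast
      then show ?thesis by (metis card_2_iff)
    qed
    show "c \<inter> d = {}" if cd: "c \<in> C" "d \<in> C" "c \<noteq> d" for c d
    proof -
      have orbit: "e = {z, f z}" if "e \<in> C" "z \<in> e" for e z
        using that assms(2) unfolding C_def by (elim imageE) fastforce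
      then show ?thesis using cd by blast
    qed
  qed
  moreover have "\<Union>C = W - U" unfolding C_def using moved by blast
  moreover have "card ((\<lambda>v. {v, f v}) ` U) = card U"
  proof -
    have "(\<lambda>v. {v, f v}) ` U = (\<lambda>v. {v}) ` U" by (auto simp: U_def unmatched_def)
    then show ?thesis by (simp add: card_image)
  qed
  moreover have "(\<lambda>v. {v, f v}) ` W = C \<union> (\<lambda>v. {v, f v}) ` U" using U by (auto simp: C_def)
  moreover have "C \<inter> (\<lambda>v. {v, f v}) ` U = {}"
  proof (intro equals0I)
    fix c assume "c \<in> C \<inter> (\<lambda>v. {v, f v}) ` U"
    then obtain v w where "v \<in> W - U" "w \<in> U" "{v, f v} = {w, f w}" by (auto simp: C_def)
    then show False by (auto simp: U_def unmatched_def)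
  qed
  ultimately show ?thesis
    using assms(1) U card_mono[OF assms(1) U]
    by (simp add: card_Un_disjoint C_def U_def[symmetric] finite_subset card_Diff_subset)
qed

context adjacency
begin

lemma chi_co_clique_le:
  assumes "clique_on E K"
  shows "chi (co E) K \<le> 1"
proof -
  interpret co: adjacency "co E" by (rule adjacency_co)
  show ?thesis using co.chi_independent_le[of K] assms by (simp add: co_co)
qed

text \<open>Give the two ends of each matching edge a common colour in the complement.\<close>

lemma chi_co_le_matching:
  assumes "finite W" "matching E W f"
  shows "2 * chi (co E) W \<le> card W + card (unmatched W f)"
proof -
  have "proper (co E) W (\<lambda>v. {v, f v})"
    unfolding proper_def
  proof (intro ballI impI notI)
    fix u v assume *: "u \<in> W" "v \<in> W" "co E u v" "{u, f u} = {v, f v}"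
    then have "v = f u" by (auto simp: co_def doubleton_eq_iff)
    then show False using * matchingD[OF assms(2) *(1)] by (auto simp: co_def)
  qed
  then have "chi (co E) W \<le> card ((\<lambda>v. {v, f v}) ` W)"
    using assms(1) by (intro chi_le_card_colours[where c = "\<lambda>v. {v, f v}"]) auto
  then show ?thesis
    using card_two_element_fibres[OF assms(1), of f] matchingD[OF assms(2)] by fastforce
qed

text \<open>If the matching yields an optimal colouring of the complement, then it does so on every union \<open>W\<close> of
its orbits: a better partition of \<open>W\<close> into cliques, together with the matching outside \<open>W\<close>, would be
better on all of \<open>V\<close>.\<close>

lemma tight_matching_local:
  assumes fin: "finite V" and f: "matching E V f"
    and tight: "card V + card (unmatched V f) = 2 * chi (co E) V"
    and W: "W \<subseteq> V" "\<And>w. w \<in> W \<Longrightarrow> f w \<in> W"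
  shows "card W + card (unmatched W f) \<le> 2 * chi (co E) W"
proof -
  interpret co: adjacency "co E" by (rule adjacency_co)
  have finW: "finite W" "finite (V - W)" using fin W(1) finite_subset by auto
  have "matching E (V - W) f"
    unfolding matching_def
  proof
    fix v assume v: "v \<in> V - W"
    then have "v \<in> V" by simp
    note fv = matchingD[OF f this]
    have "f v \<notin> W" using W(2)[of "f v"] fv(2) v by auto
    then show "f v \<in> V - W \<and> f (f v) = v \<and> (f v \<noteq> v \<longrightarrow> E v (f v))" using fv by simp
  qed
  from chi_co_le_matching[OF finW(2) this]
  have "2 * chi (co E) (V - W) \<le> card (V - W) + card (unmatched (V - W) f)" .
  moreover have "chi (co E) V \<le> chi (co E) W + chi (co E) (V - W)"
    using co.chi_Un_le[OF finW] W(1) by (simp add: Un_absorb1)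
  moreover have "card V = card W + card (V - W)"
    using card_Diff_subset[OF finW(1) W(1)] card_mono[OF fin W(1)] by simp
  moreover have "card (unmatched V f) = card (unmatched W f) + card (unmatched (V - W) f)"
  proof -
    have "unmatched V f = unmatched W f \<union> unmatched (V - W) f" using W(1) by (auto simp: unmatched_def)
    moreover have "unmatched W f \<inter> unmatched (V - W) f = {}" by (auto simp: unmatched_def)
    ultimately show ?thesis using finW by (simp add: card_Un_disjoint unmatched_def)
  qed
  ultimately show ?thesis using tight by linarith
qed

lemma maximum_matching:
  obtains f where "matching E V f" "\<And>g. matching E V g \<Longrightarrow> card (unmatched V f) \<le> card (unmatched V g)"
proof -
  have "matching E V (\<lambda>v. v)" by (simp add: matching_def)
  then show ?thesis
    using ex_has_least_nat[of "matching E V" "\<lambda>v. v" "\<lambda>f. card (unmatched V f)"] that by blast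
qed

text \<open>Matching \<open>u\<close> with its neighbour \<open>x\<close> sets free the former partner of \<open>x\<close>. This moves the unmatched
vertex along a path without changing the size of the matching.\<close>

lemma shift_unmatched:
  assumes f: "matching E V f" and U: "unmatched V f = {u}" and x: "x \<in> V" "E u x"
  obtains g where "matching E V g" "unmatched V g = {f x}"
    "\<And>v. v \<notin> {u, x, f x} \<Longrightarrow> g v = f v"
proof
  let ?g = "f(u := x, x := u, f x := f x)"
  have u: "u \<in> V" "f u = u" using U by (auto simp: unmatched_def)
  have xu: "x \<noteq> u" using x irrefl by metis
  have fx: "f x \<noteq> x" using U x(1) xu by (auto simp: unmatched_def)
  have fxu: "f x \<noteq> u" using matchingD(2)[OF f x(1)] u xu by metis
  have other: "f v \<notin> {u, x, f x}" if "v \<in> V" "v \<notin> {u, x, f x}" for v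
    using matchingD(2)[OF f that(1)] that u matchingD(2)[OF f x(1)] by auto
  show "matching E V ?g"
    unfolding matching_def
  proof
    fix v assume v: "v \<in> V"
    show "?g v \<in> V \<and> ?g (?g v) = v \<and> (?g v \<noteq> v \<longrightarrow> E v (?g v))"
    proof (cases "v \<in> {u, x, f x}")
      case True
      then show ?thesis using u x xu fx fxu sym[OF x(2)] matchingD(1)[OF f x(1)] by auto
    next
      case False
      then show ?thesis using other[OF v False] matchingD[OF f v] by auto
    qed
  qed
  show "unmatched V ?g = {f x}"
    using U xu fx fxu matchingD(1)[OF f x(1)] by (auto simp: unmatched_def split: if_splits)
qed auto

text \<open>An augmenting path \<open>u, x, f x, v\<close>, or a single edge if \<open>x\<close> is itself unmatched.\<close>

lemma augment:
  assumes f: "matching E V f" and fin: "finite V"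
    and uv: "u \<in> unmatched V f" "v \<in> unmatched V f" "u \<noteq> v"
    and x: "x \<in> V" "E u x" "f x = x \<or> E v (f x)"
  obtains g where "matching E V g" "card (unmatched V g) < card (unmatched V f)"
proof
  let ?g = "if f x = x then f(u := x, x := u) else f(u := x, x := u, v := f x, f x := v)"
  have u: "u \<in> V" "f u = u" "v \<in> V" "f v = v" using uv by (auto simp: unmatched_def)
  have xu: "x \<noteq> u" using x irrefl by metis
  have xv: "x \<noteq> v \<and> f x \<noteq> v \<and> E v (f x)" if "f x \<noteq> x" using u x(3) that irrefl by metis
  have fxu: "f x \<noteq> u" using matchingD(2)[OF f x(1)] u xu by metis
  have other: "f w \<notin> {u, x, f x}" if "w \<in> V" "w \<notin> {u, x, f x}" for w
    using matchingD(2)[OF f that(1)] that u matchingD(2)[OF f x(1)] by auto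
  have otherv: "f w \<noteq> v" if "w \<in> V" "w \<noteq> v" for w
    using matchingD(2)[OF f that(1)] that u by auto
  show "matching E V ?g"
    unfolding matching_def
  proof
    fix w assume w: "w \<in> V"
    show "?g w \<in> V \<and> ?g (?g w) = w \<and> (?g w \<noteq> w \<longrightarrow> E w (?g w))"
    proof (cases "f x = x")
      case True
      show ?thesis
      proof (cases "w \<in> {u, x}")
        case True
        then show ?thesis using u x xu sym[OF x(2)] \<open>f x = x\<close> by auto
      next
        case False
        then show ?thesis using other[of w] w matchingD[OF f w] \<open>f x = x\<close> by auto
      qed
    next
      case moved: False
      then have xv: "x \<noteq> v" "f x \<noteq> v" "E v (f x)" using xv by auto
      show ?thesis
      proof (cases "w \<in> {u, x, f x, v}")
        case True
        then show ?thesis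
          using u x xu xv fxu uv(3) moved sym[OF x(2)] sym[OF xv(3)] matchingD[OF f x(1)] by auto
      next
        case False
        then show ?thesis using other[of w] otherv[of w] w moved matchingD[OF f w] by auto
      qed
    qed
  qed
  have "unmatched V ?g \<subseteq> unmatched V f - {u}"
    using u xu xv fxu uv(3) by (auto simp: unmatched_def split: if_splits)
  then have "card (unmatched V ?g) \<le> card (unmatched V f - {u})"
    using fin by (intro card_mono) (auto simp: unmatched_def)
  also have "\<dots> < card (unmatched V f)"
    using fin uv(1) by (intro card_Diff1_less) (auto simp: unmatched_def)
  finally show "card (unmatched V ?g) < card (unmatched V f)" .
qed

end


section \<open>Regular extremal graphs\<close>

text \<open>The numbers \<open>d\<close> and \<open>e\<close> are the degrees in the graph and in its complement, which makes the
situation symmetric under complementation.\<close>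

locale regular_extremal = adjacency E for E :: "'a \<Rightarrow> 'a \<Rightarrow> bool" +
  fixes V :: "'a set" and d e :: nat
  assumes fin: "finite V" and card_V: "card V = Suc (d + e)"
    and regular: "v \<in> V \<Longrightarrow> deg E V v = d"
    and chi_V: "chi E V = Suc d" and chi_co_V: "chi (co E) V = Suc e"
begin

lemma regular_extremal_co: "regular_extremal (co E) V e d"
proof -
  interpret co: adjacency "co E" by (rule adjacency_co)
  show ?thesis
    by unfold_locales
      (use deg_co[OF fin] regular card_V in \<open>force simp: fin card_V co_co chi_V chi_co_V\<close>)+
qed

lemma matching_size:
  assumes "matching E V f"
  shows "Suc e \<le> d + card (unmatched V f)"
  using chi_co_le_matching[OF fin assms] card_V chi_co_V by linarith

text \<open>The hypothesis on \<open>f\<close> says that it has \<open>d\<close> edges, the most that the clique covers of \<open>V\<close> allow.\<close>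

lemma near_perfect_local:
  assumes "matching E V f" "d + card (unmatched V f) = Suc e"
    "W \<subseteq> V" "\<And>w. w \<in> W \<Longrightarrow> f w \<in> W"
  shows "card W + card (unmatched W f) \<le> 2 * chi (co E) W"
  by (rule tight_matching_local[OF fin assms(1) _ assms(3,4)])
    (use assms(2) card_V chi_co_V in simp_all)

text \<open>A triangle formed by a matching edge and an unmatched vertex would be one clique in place of two.\<close>

lemma no_triangle_at_unmatched:
  assumes f: "matching E V f" "d + card (unmatched V f) = Suc e"
    and u: "u \<in> unmatched V f" and x: "x \<in> V" "E u x"
  shows "\<not> E u (f x)"
proof
  assume fx: "E u (f x)"
  have uV: "u \<in> V" "f u = u" using u by (auto simp: unmatched_def)
  have ne: "x \<noteq> u" "f x \<noteq> u" using x fx irrefl by metis+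
  note m = matchingD[OF f(1) x(1)]
  let ?W = "{u, x, f x}"
  have "card ?W + card (unmatched ?W f) \<le> 2 * chi (co E) ?W"
    by (rule near_perfect_local[OF f]) (use uV x m in auto)
  moreover have "clique_on E ?W"
    using x(2) fx m(3) sym by (auto simp: clique_on_def)
  then have "chi (co E) ?W \<le> 1" by (rule chi_co_clique_le)
  moreover have "4 \<le> card ?W + card (unmatched ?W f)"
  proof (cases "f x = x")
    case True
    then have "unmatched ?W f = {u, x}" using uV by (auto simp: unmatched_def)
    then show ?thesis using True ne by simp
  next
    case False
    then have "unmatched ?W f = {u}" using uV m(2) False by (auto simp: unmatched_def)
    then show ?thesis using False ne by auto
  qed
  ultimately show False by linarith
qed

text \<open>Suppose a maximum matching leaves at least two vertices unmatched. For unmatched \<open>u \<noteq> v\<close> the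
neighbours of \<open>u\<close> and the partners of the neighbours of \<open>v\<close> are disjoint, since otherwise the matching
could be augmented. Both are sets of \<open>d\<close> matched vertices, and there are at most \<open>2 d\<close> matched vertices,
so the matching is tight and all unmatched vertices have the same neighbourhood \<open>X\<close>. The partners of
\<open>X\<close> together with the unmatched vertices turn out to be independent. One colour suffices for them, so
\<open>X\<close> needs \<open>d\<close> colours and is a clique. A vertex of \<open>X\<close> then has degree at least \<open>d + 1\<close>.\<close>

lemma at_most_one_unmatched:
  assumes "d > 0"
  obtains f where "matching E V f" "card (unmatched V f) \<le> 1"
proof -
  obtain f where f: "matching E V f"
    and max: "\<And>g. matching E V g \<Longrightarrow> card (unmatched V f) \<le> card (unmatched V g)"
    using maximum_matching by blast
  define U where "U = unmatched V f"
  have UV: "U \<subseteq> V" and finU: "finite U" and fU: "\<And>u. u \<in> U \<Longrightarrow> f u = u"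
    using fin by (auto simp: U_def unmatched_def)
  have inj: "inj_on f V" using matchingD(2)[OF f] by (rule inj_on_inverseI)
  have "\<not> 2 \<le> card U"
  proof
    assume two: "2 \<le> card U"
    then obtain u0 u1 where u01: "u0 \<in> U" "u1 \<in> U" "u0 \<noteq> u1"
      using card_le_Suc0_iff_eq[OF finU] by (metis not_less_eq_eq numeral_2_eq_2)
    have other: "\<exists>w\<in>U. w \<noteq> u" for u using u01 by metis
    have no_aug: "f x \<noteq> x \<and> \<not> E v (f x)"
      if "u \<in> U" "v \<in> U" "u \<noteq> v" "x \<in> V" "E u x" for u v x
    proof (rule ccontr)
      assume "\<not> ?thesis"
      then have "f x = x \<or> E v (f x)" by blast
      then obtain g where "matching E V g" "card (unmatched V g) < card (unmatched V f)"
        using augment[OF f fin _ _ \<open>u \<noteq> v\<close> \<open>x \<in> V\<close> \<open>E u x\<close>] \<open>u \<in> U\<close> \<open>v \<in> U\<close> unfolding U_def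
        by metis
      then show False using max[of g] by simp
    qed
    have NZ: "nbrs E V u \<subseteq> V - U" if u: "u \<in> U" for u
    proof -
      obtain w where "w \<in> U" "w \<noteq> u" using other by blast
      note no_aug[OF u this(1) this(2)[symmetric]]
      then show ?thesis using fU unfolding nbrs_def by blast
    qed
    have fZ: "f ` (V - U) \<subseteq> V - U"
      using matchingD(1,2)[OF f] by (force simp: U_def unmatched_def)
    have disj: "nbrs E V u \<inter> f ` nbrs E V v = {}" if "u \<in> U" "v \<in> U" "u \<noteq> v" for u v
      using no_aug[OF that(2,1)] that(3) by (auto simp: nbrs_def)
    have deg: "card (nbrs E V u) = d" "card (f ` nbrs E V u) = d" if "u \<in> U" for u
    proof -
      show "card (nbrs E V u) = d" using regular that UV by auto
      moreover have "inj_on f (nbrs E V u)" using inj by (rule inj_on_subset) (auto simp: nbrs_def)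
      ultimately show "card (f ` nbrs E V u) = d" by (simp add: card_image)
    qed
    have finN: "finite (nbrs E V u)" for u by (rule finite_nbrs[OF fin])
    have cardZ: "card (V - U) + card U = card V"
      using card_Diff_subset[OF finU UV] card_mono[OF fin UV] by simp
    have cover: "nbrs E V u \<union> f ` nbrs E V v = V - U \<and> d + card U = Suc e"
      if "u \<in> U" "v \<in> U" "nbrs E V u \<inter> f ` nbrs E V v = {}" for u v
    proof -
      have sub: "nbrs E V u \<union> f ` nbrs E V v \<subseteq> V - U" using NZ[OF that(1)] NZ[OF that(2)] fZ by blast
      have c: "card (nbrs E V u \<union> f ` nbrs E V v) = d + d"
        using that deg finN by (simp add: card_Un_disjoint)
      have le: "d + d \<le> card (V - U)" using card_mono[OF _ sub] c fin by simp
      then have eq: "d + d = card (V - U)" "d + card U = Suc e"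
        using matching_size[OF f] cardZ card_V unfolding U_def by linarith+
      then show ?thesis using card_subset_eq[OF _ sub] c fin by simp
    qed
    have tight: "d + card (unmatched V f) = Suc e"
      using cover[OF u01(1,2) disj[OF u01]] by (simp add: U_def)
    define X where "X = nbrs E V u0"
    have self_disj: "nbrs E V u \<inter> f ` nbrs E V u = {}" if "u \<in> U" for u
      using no_triangle_at_unmatched[OF f tight] that by (auto simp: nbrs_def U_def)
    have same: "nbrs E V u = X" if u: "u \<in> U" for u
    proof (cases "u = u0")
      case False
      have "nbrs E V u \<union> f ` nbrs E V u0 = V - U" "nbrs E V u0 \<union> f ` nbrs E V u0 = V - U"
        using cover[OF u u01(1) disj[OF u u01(1) False]] cover[OF u01(1,1) self_disj[OF u01(1)]]
        by auto
      then show ?thesis using disj[OF u u01(1) False] self_disj[OF u01(1)] unfolding X_def by blast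
    qed (simp add: X_def)
    define Y where "Y = f ` X"
    have XY: "X \<union> Y = V - U" "X \<inter> Y = {}"
      using cover[OF u01(1,1) self_disj[OF u01(1)]] self_disj[OF u01(1)] by (auto simp: X_def Y_def)
    have UX: "E u x" if "u \<in> U" "x \<in> X" for u x using same[OF that(1)] that(2) by (auto simp: nbrs_def)
    have "clique_on (co E) (Y \<union> U)"
    proof -
      have nU: "\<not> E u y" if "u \<in> U" "y \<in> Y \<union> U" for u y
        using same[OF that(1)] that(2) XY UV by (auto simp: nbrs_def)
      have nY: "\<not> E y1 y2" if y: "y1 \<in> Y" "y2 \<in> Y" "y1 \<noteq> y2" for y1 y2
      proof
        assume E12: "E y1 y2"
        define x1 x2 where "x1 = f y1" and "x2 = f y2"
        have yV: "y1 \<in> V" "y2 \<in> V" using XY y by auto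
        have "f y \<in> X" if yY: "y \<in> Y" for y
        proof -
          obtain x where "y = f x" "x \<in> X" using yY by (auto simp: Y_def)
          then show ?thesis using matchingD(2)[OF f, of x] XY by (metis DiffD1 UnI1)
        qed
        then have xX: "x1 \<in> X" "x2 \<in> X" using y by (simp_all add: x1_def x2_def)
        then have xV: "x1 \<in> V" "x2 \<in> V" using XY by auto
        have fx: "f x1 = y1" "f x2 = y2" using matchingD(2)[OF f] yV by (auto simp: x1_def x2_def)
        have fy: "f y1 = x1" "f y2 = x2" by (simp_all add: x1_def x2_def)
        have dist: "distinct [u0, u1, x1, x2, y1, y2]"
          using u01 xX y XY fx by auto
        \<comment> \<open>An edge between partners would save one clique on these six vertices.\<close>
        let ?W = "({u0, x1} \<union> {u1, x2}) \<union> {y1, y2}"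
        have "card ?W + card (unmatched ?W f) \<le> 2 * chi (co E) ?W"
          by (rule near_perfect_local[OF f tight])
            (use u01 UV xV yV fU fx fy in auto)
        moreover have "unmatched ?W f = {u0, u1}"
          using dist fU[OF u01(1)] fU[OF u01(2)] fx fy by (auto simp: unmatched_def)
        moreover have "card ?W = 6" using dist by auto
        moreover have "chi (co E) ?W \<le> 3"
        proof -
          interpret co: adjacency "co E" by (rule adjacency_co)
          have "clique_on E {u0, x1}" "clique_on E {u1, x2}" "clique_on E {y1, y2}"
            using UX u01 xX E12 sym by (auto simp: clique_on_def)
          from this[THEN chi_co_clique_le] show ?thesis
            using co.chi_Un_le[of "{u0, x1} \<union> {u1, x2}" "{y1, y2}"]
              co.chi_Un_le[of "{u0, x1}" "{u1, x2}"] by simp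
        qed
        ultimately show False using dist by simp
      qed
      show ?thesis
        unfolding clique_on_def co_def using nU nY sym by blast
    qed
    then have chiYU: "chi E (Y \<union> U) \<le> 1" by (rule chi_independent_le)
    have finX: "finite X" and cardX: "card X = d" using finN deg[OF u01(1)] by (auto simp: X_def)
    have "V = (Y \<union> U) \<union> X" using XY UV by blast
    then have "chi E V \<le> chi E (Y \<union> U) + chi E X"
      using chi_Un_le[of "Y \<union> U" X] finX finU by (simp add: Y_def)
    then have "chi E X = card X" using chi_V chiYU chi_le_card[OF finX] cardX by linarith
    then have clX: "clique_on E X" by (rule chi_eq_card_imp_clique[OF finX])
    obtain x where x: "x \<in> X" using cardX assms by fastforce
    have "insert u0 (insert u1 (X - {x})) \<subseteq> nbrs E V x"
      using clX x UX u01 UV XY sym by (auto simp: clique_on_def nbrs_def)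
    then have "card (insert u0 (insert u1 (X - {x}))) \<le> d"
      using card_mono[OF finN] regular[of x] x XY by (metis Diff_iff UnI1)
    moreover have "u0 \<notin> X" "u1 \<notin> X" using XY u01 by auto
    ultimately show False using u01 finX x cardX by simp
  qed
  then show ?thesis using that[OF f] unfolding U_def by simp
qed

text \<open>There are \<open>d\<close> matching edges and \<open>u\<close> has \<open>d\<close> neighbours, at most one on each edge.\<close>

lemma exactly_one_of_pair:
  assumes ed: "e = d" and f: "matching E V f" "unmatched V f = {u}" and x: "x \<in> V" "x \<noteq> u"
  shows "E u (f x) \<longleftrightarrow> \<not> E u x"
proof -
  have tight: "d + card (unmatched V f) = Suc e" using ed f(2) by simp
  have u: "u \<in> V" "f u = u" using f(2) by (auto simp: unmatched_def)
  have no: "\<not> E u (f y)" if "y \<in> V" "E u y" for y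
    using no_triangle_at_unmatched[OF f(1) tight _ that] f(2) by simp
  let ?N = "nbrs E V u"
  have NV: "?N \<subseteq> V - {u}" using irrefl by (auto simp: nbrs_def)
  have inj: "inj_on f V" using matchingD(2)[OF f(1)] by (rule inj_on_inverseI)
  have fNV: "f ` ?N \<subseteq> V - {u}"
  proof
    fix z assume "z \<in> f ` ?N"
    then obtain y where y: "z = f y" "y \<in> V" "E u y" by (auto simp: nbrs_def)
    have "f y \<noteq> u" using matchingD(2)[OF f(1) y(2)] u(2) y(3) irrefl by metis
    then show "z \<in> V - {u}" using matchingD(1)[OF f(1) y(2)] y(1) by simp
  qed
  have finN: "finite ?N" by (rule finite_nbrs[OF fin])
  have "card (f ` ?N) = d"
    using inj_on_subset[OF inj, of ?N] regular[OF u(1)] by (simp add: card_image nbrs_def)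
  moreover have "?N \<inter> f ` ?N = {}" using no by (auto simp: nbrs_def)
  ultimately have "card (?N \<union> f ` ?N) = d + d"
    using finN regular[OF u(1)] by (simp add: card_Un_disjoint)
  moreover have "card (V - {u}) = d + d" using fin u(1) card_V ed by simp
  ultimately have "?N \<union> f ` ?N = V - {u}"
    using NV fNV fin by (intro card_subset_eq) auto
  then have "x \<in> ?N \<union> f ` ?N" using x by simp
  then have "E u x \<or> E u (f x)"
    using matchingD(2)[OF f(1)] by (auto simp: nbrs_def)
  then show ?thesis using no[OF x(1)] by blast
qed

text \<open>Write \<open>x\<close> for a neighbour of the unmatched vertex \<open>u\<close> and \<open>y = f x\<close> for its partner. Shifting the
unmatched vertex and applying \<open>exactly_one_of_pair\<close> again decides most adjacencies. For every \<open>x\<close> there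
is another \<open>x'\<close> with \<open>y\<close> and \<open>y'\<close> adjacent, so that \<open>u, x, y, y', x'\<close> is an induced 5-cycle. A third
neighbour \<open>z\<close> of \<open>u\<close> would be adjacent to both \<open>y\<close> and \<open>y'\<close>, and its partner to \<open>x\<close>; the triangle
\<open>z, y, y'\<close> then belongs to a partition of seven vertices into three cliques, where a tight matching
needs four.\<close>

lemma balanced_imp_degree_two:
  assumes ed: "e = d" and d: "d > 0"
  shows "d = 2"
proof -
  interpret co: adjacency "co E" by (rule adjacency_co)
  obtain f where f: "matching E V f" "card (unmatched V f) \<le> 1"
    using at_most_one_unmatched[OF d] by blast
  then have "card (unmatched V f) = 1" using matching_size[OF f(1)] ed by linarith
  then obtain u where U: "unmatched V f = {u}" by (auto simp: card_1_singleton_iff)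
  have tight: "d + card (unmatched V f) = Suc e" using ed U by simp
  have u: "u \<in> V" "f u = u" using U by (auto simp: unmatched_def)
  define X where "X = nbrs E V u"
  have finX: "finite X" and cardX: "card X = d"
    using finite_nbrs[OF fin] regular[OF u(1)] by (auto simp: X_def)
  have XD: "x \<in> V" "E u x" "E x u" "x \<noteq> u" "f x \<in> V" "f (f x) = x" "f x \<noteq> x" "f x \<noteq> u"
    "\<not> E u (f x)" "E x (f x)" "E (f x) x" if "x \<in> X" for x
  proof -
    show x: "x \<in> V" "E u x" using that by (auto simp: X_def nbrs_def)
    show "E x u" using x sym by blast
    show xu: "x \<noteq> u" using x irrefl by metis
    show "f x \<in> V" "f (f x) = x" using matchingD[OF f(1) x(1)] by auto
    then show "f x \<noteq> u" using u(2) xu by metis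
    show "f x \<noteq> x" using U x(1) xu by (auto simp: unmatched_def)
    then show "E x (f x)" "E (f x) x" using matchingD[OF f(1) x(1)] sym by auto
    show "\<not> E u (f x)" using exactly_one_of_pair[OF ed f(1) U x(1) xu] x(2) by blast
  qed
  have sep: "f x \<noteq> f x'" "f x \<noteq> x'" "f x' \<noteq> x" if "x \<in> X" "x' \<in> X" "x \<noteq> x'" for x x'
    using XD[OF that(1)] XD[OF that(2)] that(3) by metis+
  have one: "E (f x) x' \<longleftrightarrow> \<not> E (f x) (f x')" if x: "x \<in> X" "x' \<in> X" "x \<noteq> x'" for x x'
  proof -
    obtain g where g: "matching E V g" "unmatched V g = {f x}"
      "\<And>v. v \<notin> {u, x, f x} \<Longrightarrow> g v = f v"
      using shift_unmatched[OF f(1) U XD(1,2)[OF x(1)]] by blast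
    have "g x' = f x'" using g(3)[of x'] sep[OF x] x(3) XD(4)[OF x(2)] by auto
    then show ?thesis
      using exactly_one_of_pair[OF ed g(1,2) XD(1)[OF x(2)]] sep[OF x] by auto
  qed
  have two: "\<not> E (f x) (f x')" if x: "x \<in> X" "x' \<in> X" "x \<noteq> x'" "E x x'" for x x'
  proof
    assume E: "E (f x) (f x')"
    note D = XD[OF x(1)] XD[OF x(2)] sep[OF x(1-3)]
    \<comment> \<open>A triangle and an edge in place of two matching edges and the single vertex \<open>u\<close>.\<close>
    let ?W = "{u, x, x'} \<union> {f x, f x'}"
    have "card ?W + card (unmatched ?W f) \<le> 2 * chi (co E) ?W"
      by (rule near_perfect_local[OF f(1) tight]) (use u D in auto)
    moreover have "unmatched ?W f = {u}" using u D x(3) by (auto simp: unmatched_def)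
    moreover have "distinct [u, x, x', f x, f x']" using D x(3) by auto
    then have "card ?W = 5" by auto
    moreover have "clique_on E {u, x, x'}" "clique_on E {f x, f x'}"
      using D x(4) E sym by (auto simp: clique_on_def)
    then have "chi (co E) ?W \<le> 2"
      using co.chi_Un_le[of "{u, x, x'}" "{f x, f x'}"] by (auto dest!: chi_co_clique_le)
    ultimately show False by simp
  qed
  have three: "E x' (f z) \<longleftrightarrow> \<not> E x' z"
    if x: "x \<in> X" "x' \<in> X" "x \<noteq> x'" "E (f x) (f x')" and z: "z \<in> X" "z \<noteq> x" "z \<noteq> x'" for x x' z
  proof -
    note D = XD[OF x(1)] XD[OF x(2)] XD[OF z(1)] sep[OF x(1-3)] sep[OF z(1) x(1) z(2)] sep[OF z(1) x(2) z(3)]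
    obtain g where g: "matching E V g" "unmatched V g = {f x}"
      "\<And>v. v \<notin> {u, x, f x} \<Longrightarrow> g v = f v"
      using shift_unmatched[OF f(1) U XD(1,2)[OF x(1)]] by blast
    have gx': "g (f x') = x'" using g(3)[of "f x'"] D by auto
    \<comment> \<open>A second shift, along the edge from \<open>f x\<close> to \<open>f x'\<close>, leaves \<open>x'\<close> unmatched.\<close>
    obtain h where h: "matching E V h" "unmatched V h = {x'}"
      "\<And>v. v \<notin> {f x, f x', x'} \<Longrightarrow> h v = g v"
      using shift_unmatched[OF g(1,2) _ x(4)] D(16) unfolding gx' by blast
    have "h z = f z" using h(3)[of z] g(3)[of z] D z by auto
    then show ?thesis using exactly_one_of_pair[OF ed h(1,2), of z] D z by auto
  qed
  have ex: "\<exists>x'\<in>X. x' \<noteq> x \<and> E (f x) (f x')" if x: "x \<in> X" for x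
  proof (rule ccontr)
    assume none: "\<not> ?thesis"
    have "insert u (f ` X) \<subseteq> nbrs E V x"
    proof -
      have "f x' \<in> nbrs E V x" if x': "x' \<in> X" for x'
      proof (cases "x' = x")
        case True
        then show ?thesis using XD[OF x] by (simp add: nbrs_def)
      next
        case False
        then have "\<not> E (f x') (f x)" using none x' sym by blast
        then have "E (f x') x" using one[OF x' x False] by blast
        then show ?thesis using sym XD(5)[OF x'] by (simp add: nbrs_def)
      qed
      then show ?thesis using u XD[OF x] by (auto simp: nbrs_def)
    qed
    then have "card (insert u (f ` X)) \<le> d"
      using card_mono[OF finite_nbrs[OF fin]] regular[OF XD(1)[OF x]] by metis
    moreover have "u \<notin> f ` X" using XD(8) by auto
    moreover have "inj_on f X" using XD(6) by (rule inj_on_inverseI)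
    ultimately show False using finX cardX by (simp add: card_image)
  qed
  obtain x where x: "x \<in> X" using cardX d by fastforce
  obtain x' where x': "x' \<in> X" "x' \<noteq> x" "E (f x) (f x')" using ex[OF x] by blast
  have "X = {x, x'}"
  proof (rule ccontr)
    assume "X \<noteq> {x, x'}"
    then obtain z where z: "z \<in> X" "z \<noteq> x" "z \<noteq> x'" using x x'(1) by blast
    have no_y: "\<not> E (f v) (f z)" if v: "v \<in> X" "w \<in> X" "v \<noteq> w" "E (f w) (f v)" "z \<noteq> v" "z \<noteq> w" for v w
    proof
      assume E: "E (f v) (f z)"
      then have Ezv: "E (f z) (f v)" by (rule sym)
      then have "\<not> E (f z) v" using one[OF z(1) v(1) v(5)] by blast
      then have "\<not> E v (f z)" using sym by blast
      then have "E v z" using three[OF v(2,1) v(3)[symmetric] v(4) z(1) v(6,5)] by blast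
      then show False using two[OF v(1) z(1) v(5)[symmetric]] E by blast
    qed
    have n: "\<not> E (f x) (f z)" "\<not> E (f x') (f z)"
      using no_y[OF x x'(1) x'(2)[symmetric] sym[OF x'(3)] z(2,3)]
        no_y[OF x'(1) x x'(2) x'(3) z(3,2)] by auto
    have Ez: "E (f x) z" "E (f x') z" "E (f z) x"
      using one[OF x z(1) z(2)[symmetric]] one[OF x'(1) z(1) z(3)[symmetric]] one[OF z(1) x z(2)]
        n sym by blast+
    note D = XD[OF x] XD[OF x'(1)] XD[OF z(1)] sep[OF x x'(1) x'(2)[symmetric]]
      sep[OF z(1) x z(2)] sep[OF z(1) x'(1) z(3)] x'(2) z(2,3)
    \<comment> \<open>Three cliques on seven vertices.\<close>
    let ?W = "({z, f x, f x'} \<union> {u, x'}) \<union> {f z, x}"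
    have "card ?W + card (unmatched ?W f) \<le> 2 * chi (co E) ?W"
      by (rule near_perfect_local[OF f(1) tight]) (use u D in auto)
    moreover have "unmatched ?W f = {u}" using u D by (auto simp: unmatched_def)
    moreover have "distinct [u, x, x', z, f x, f x', f z]" using D by auto
    then have "card ?W = 7" by auto
    moreover have "clique_on E {z, f x, f x'}" "clique_on E {u, x'}" "clique_on E {f z, x}"
      using D Ez x'(3) sym by (auto simp: clique_on_def)
    from this[THEN chi_co_clique_le] have "chi (co E) ?W \<le> 3"
      using co.chi_Un_le[of "{z, f x, f x'} \<union> {u, x'}" "{f z, x}"]
        co.chi_Un_le[of "{z, f x, f x'}" "{u, x'}"] by simp
    ultimately show False by simp
  qed
  then show "d = 2" using cardX x'(2) by auto
qed

text \<open>Both the graph and its complement have a matching with at most one unmatched vertex, which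
forces \<open>d = e\<close>.\<close>

theorem regular_extremal_shape:
  "clique_on E V \<or> clique_on (co E) V \<or> (card V = 5 \<and> (\<forall>v\<in>V. deg E V v = 2))"
proof -
  interpret co: regular_extremal "co E" V e d by (rule regular_extremal_co)
  consider "d = 0" | "e = 0" | "d > 0" "e > 0" by blast
  then show ?thesis
  proof cases
    case 1
    then have "nbrs E V v = {}" if "v \<in> V" for v using regular[OF that] finite_nbrs[OF fin, of E v] by simp
    then show ?thesis by (auto simp: clique_on_def co_def nbrs_def)
  next
    case 2
    then have "nbrs (co E) V v = {}" if "v \<in> V" for v
      using co.regular[OF that] finite_nbrs[OF fin, of "co E" v] by simp
    then show ?thesis by (auto simp: clique_on_def co_def nbrs_def)
  next
    case 3
    obtain f where "matching E V f" "card (unmatched V f) \<le> 1"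
      using at_most_one_unmatched[OF 3(1)] .
    then have "e \<le> d" using matching_size by fastforce
    moreover obtain g where "matching (co E) V g" "card (unmatched V g) \<le> 1"
      using co.at_most_one_unmatched[OF 3(2)] .
    then have "d \<le> e" using co.matching_size by fastforce
    ultimately have "e = d" by simp
    then show ?thesis using balanced_imp_degree_two 3 card_V regular by auto
  qed
qed

end


section \<open>The degree partition of an extremal graph\<close>

text \<open>For simple graphs these are the 5-cycles; in this form the property is visibly closed under
complement and is what the program tests.\<close>

definition five_regular :: "('a \<Rightarrow> 'a \<Rightarrow> bool) \<Rightarrow> 'a set \<Rightarrow> bool" where
  "five_regular E A \<longleftrightarrow> card A = 5 \<and> (\<forall>v\<in>A. deg E A v = 2)"

text \<open>Questions (i) to (v) for given \<open>A\<close>, \<open>B\<close>, \<open>C\<close>, as a condition invariant under complementing the graph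
and exchanging \<open>B\<close> with \<open>C\<close>.\<close>

definition NG_partition :: "('a \<Rightarrow> 'a \<Rightarrow> bool) \<Rightarrow> 'a set \<Rightarrow> 'a set \<Rightarrow> 'a set \<Rightarrow> bool" where
  "NG_partition E A B C \<longleftrightarrow>
     A \<noteq> {} \<and> A \<inter> B = {} \<and> A \<inter> C = {} \<and> B \<inter> C = {} \<and>
     (clique_on E A \<or> clique_on (co E) A \<or> five_regular E A) \<and>
     clique_on E B \<and> clique_on (co E) C \<and>
     (\<forall>a\<in>A. \<forall>b\<in>B. E a b) \<and> (\<forall>a\<in>A. \<forall>c\<in>C. \<not> E a c)"

text \<open>The decomposition obtained from critical subsets. It is invariant under complementing the graph
and exchanging \<open>B\<close> with \<open>C\<close>, but differs from the partition by degree: vertices in \<open>B\<close> or \<open>C\<close> can have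
the same degree as those in \<open>A\<close>.\<close>

locale extremal_parts = adjacency E for E :: "'a \<Rightarrow> 'a \<Rightarrow> bool" +
  fixes V A B C :: "'a set"
  assumes fin: "finite V" and V: "V = A \<union> B \<union> C"
    and disj: "A \<inter> B = {}" "A \<inter> C = {}" "B \<inter> C = {}" and ne: "A \<noteq> {}"
    and B: "clique_on E B" and C: "clique_on (co E) C"
    and AB: "a \<in> A \<Longrightarrow> b \<in> B \<Longrightarrow> E a b" and AC: "a \<in> A \<Longrightarrow> c \<in> C \<Longrightarrow> \<not> E a c"
    and chi_V: "chi E V = chi E A + card B" and chi_co_V: "chi (co E) V = chi (co E) A + card C"
    and NG_A: "chi E A + chi (co E) A = Suc (card A)"
    and deg_A: "a \<in> A \<Longrightarrow> Suc (deg E V a) = chi E V"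

context adjacency
begin

text \<open>The parts are the overlap and the two differences of critical subsets for the graph and for its
complement. Since \<open>\<chi>(G) + \<chi>(co G)\<close> attains its maximum, every estimate used is an equality.\<close>

lemma extremal_parts_exist:
  assumes fin: "finite V" and NG: "chi E V + chi (co E) V = Suc (card V)"
  obtains A B C where "extremal_parts E V A B C"
proof -
  interpret co: adjacency "co E" by (rule adjacency_co)
  obtain S where S: "S \<subseteq> V" "chi E S = chi E V" "\<And>v. v \<in> S \<Longrightarrow> chi E V \<le> Suc (deg E S v)"
    using critical_subset[OF fin] by blast
  obtain T where T: "T \<subseteq> V" "chi (co E) T = chi (co E) V"
    "\<And>v. v \<in> T \<Longrightarrow> chi (co E) V \<le> Suc (deg (co E) T v)"
    using co.critical_subset[OF fin] by blast
  have finST: "finite S" "finite T" using S(1) T(1) fin finite_subset by blast+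
  define A B C where "A = S \<inter> T" and "B = S - T" and "C = T - S"
  have finABC: "finite A" "finite B" "finite C" unfolding A_def B_def C_def using finST by auto
  have ne: "A \<noteq> {}"
  proof
    assume "A = {}"
    then have "card S + card T = card (S \<union> T)"
      unfolding A_def using finST by (simp add: card_Un_disjoint)
    also have "\<dots> \<le> card V" using S(1) T(1) fin by (intro card_mono) auto
    finally show False
      using chi_le_card[OF finST(1)] co.chi_le_card[OF finST(2)] S(2) T(2) NG by linarith
  qed
  \<comment> \<open>The two degrees of \<open>a\<close> add up to the sum of their lower bounds inside \<open>S\<close> and \<open>T\<close>.\<close>
  have tight: "Suc (deg E V a) = chi E V \<and> nbrs E V a \<subseteq> S \<and> nbrs (co E) V a \<subseteq> T"
    if "a \<in> A" for a
  proof -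
    have a: "a \<in> S" "a \<in> T" "a \<in> V" using that S(1) unfolding A_def by auto
    have "deg E V a = deg E S a" "deg (co E) V a = deg (co E) T a" "Suc (deg E V a) = chi E V"
      using S(3)[OF a(1)] T(3)[OF a(2)] deg_mono[OF fin S(1), of a]
        co.deg_mono[OF fin T(1), of a] deg_co[OF fin a(3)] NG by linarith+
    moreover have "nbrs E S a \<subseteq> nbrs E V a" "nbrs (co E) T a \<subseteq> nbrs (co E) V a"
      using S(1) T(1) by (auto simp: nbrs_def)
    ultimately have "nbrs E S a = nbrs E V a" "nbrs (co E) T a = nbrs (co E) V a"
      by (simp_all add: card_subset_eq finite_nbrs fin)
    then show ?thesis using \<open>Suc (deg E V a) = chi E V\<close> by (auto simp: nbrs_def)
  qed
  have AB: "E a b" if "a \<in> A" "b \<in> B" for a b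
    using tight[OF that(1)] that S(1) unfolding A_def B_def nbrs_def co_def by blast
  have AC: "\<not> E a c" if "a \<in> A" "c \<in> C" for a c
    using tight[OF that(1)] that T(1) unfolding A_def C_def nbrs_def by blast
  have V: "V = A \<union> B \<union> C"
  proof -
    obtain a where a: "a \<in> A" using ne by blast
    \<comment> \<open>One vertex of \<open>A\<close> sees all of \<open>V\<close>, in the graph or in its complement.\<close>
    have "V \<subseteq> insert a (nbrs E V a \<union> nbrs (co E) V a)" by (auto simp: nbrs_def co_def)
    then show ?thesis using tight[OF a] a S(1) T(1) unfolding A_def B_def C_def by blast
  qed
  have card: "card V = card A + card B + card C"
    unfolding V using finABC by (subst card_Un_disjoint; auto simp: A_def B_def C_def card_Un_disjoint)+
  have "A \<union> B = S" "A \<union> C = T" unfolding A_def B_def C_def by auto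
  then have sub: "chi E V \<le> chi E A + chi E B" "chi (co E) V \<le> chi (co E) A + chi (co E) C"
    using chi_Un_le[OF finABC(1,2)] co.chi_Un_le[OF finABC(1,3)] S(2) T(2) by simp_all
  note bounds = sub chi_le_card[OF finABC(2)] co.chi_le_card[OF finABC(3)]
    nordhaus_gaddum[OF finABC(1)] NG card
  have eq: "chi E B = card B" "chi (co E) C = card C" "chi E V = chi E A + card B"
    "chi (co E) V = chi (co E) A + card C" "chi E A + chi (co E) A = Suc (card A)"
    using bounds by linarith+
  have "extremal_parts E V A B C"
  proof (unfold_locales, goal_cases)
    case 7
    show ?case using chi_eq_card_imp_clique[OF finABC(2) eq(1)] .
  next
    case 8
    show ?case using co.chi_eq_card_imp_clique[OF finABC(3) eq(2)] .
  qed (use fin V ne AB AC eq tight in \<open>auto simp: A_def B_def C_def\<close>)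
  then show ?thesis by (rule that)
qed


lemma five_regular_co:
  assumes "five_regular E A"
  shows "five_regular (co E) A"
  using deg_co[of A] assms card_ge_0_finite[of A] by (fastforce simp: five_regular_def)

text \<open>Walk from \<open>a\<close> in both directions. If the walk closed up after three or four vertices, the remaining
ones could not have degree 2.\<close>

lemma five_regular_cycle:
  assumes "five_regular E A"
  obtains a b c d e where "distinct [a, b, c, d, e]" "A = {a, b, c, d, e}"
    "nbrs E A a = {b, e}" "nbrs E A b = {a, c}" "nbrs E A c = {b, d}"
    "nbrs E A d = {c, e}" "nbrs E A e = {d, a}"
proof -
  have five: "card A = 5" and two: "\<And>v. v \<in> A \<Longrightarrow> card (nbrs E A v) = 2"
    using assms by (auto simp: five_regular_def)
  have finA: "finite A" using five by (simp add: card_ge_0_finite)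
  have NS: "u \<in> nbrs E A v \<longleftrightarrow> v \<in> nbrs E A u" if "u \<in> A" "v \<in> A" for u v
    using that sym by (auto simp: nbrs_def)
  have NA: "nbrs E A v \<subseteq> A - {v}" for v using irrefl by (auto simp: nbrs_def)
  have pair: "\<exists>y. y \<noteq> x \<and> nbrs E A v = {x, y}" if vx: "v \<in> A" "x \<in> nbrs E A v" for v x
  proof -
    obtain p q where "nbrs E A v = {p, q}" "p \<noteq> q" using two[OF vx(1)] card_2_iff by metis
    then show ?thesis using vx(2) by (cases "x = p") (auto simp: insert_commute)
  qed
  have eqI: "nbrs E A v = {x, y}" if "v \<in> A" "nbrs E A v \<subseteq> {x, y}" "x \<noteq> y" for v x y
    using card_subset_eq[OF _ that(2)] two[OF that(1)] that(3) by simp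
  obtain a where a: "a \<in> A" using five by fastforce
  obtain b e where ab: "nbrs E A a = {b, e}" "b \<noteq> e" using two[OF a] card_2_iff by metis
  then have abe: "b \<in> A" "e \<in> A" "a \<noteq> b" "a \<noteq> e" using NA[of a] by auto
  obtain c where c: "nbrs E A b = {a, c}" "c \<noteq> a" using pair[OF abe(1), of a] NS[OF a abe(1)] ab by auto
  obtain d where d: "nbrs E A e = {d, a}" "d \<noteq> a"
    using pair[OF abe(2), of a] NS[OF a abe(2)] ab by (auto simp: insert_commute)
  have cd: "c \<in> A" "d \<in> A" "c \<noteq> b" "d \<noteq> e" using c d NA[of b] NA[of e] by auto
  have ce: "c \<noteq> e"
  proof
    assume "c = e"
    then have "b \<in> nbrs E A e" using c NS[OF abe(1,2)] by simp
    then have N: "nbrs E A b = {a, e}" "nbrs E A e = {a, b}"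
      using c d abe \<open>c = e\<close> by auto
    have "card (A - {a, b, e}) = 2" using five a abe ab(2) finA by (simp add: card_Diff_subset)
    then obtain p q where pq: "A - {a, b, e} = {p, q}" "p \<noteq> q" using card_2_iff by metis
    then have p: "p \<in> A" "p \<notin> {a, b, e}" by auto
    have "nbrs E A p \<subseteq> {q}"
    proof
      fix z assume z: "z \<in> nbrs E A p"
      then have "z \<in> A" "z \<noteq> p" "p \<in> nbrs E A z" using NA[of p] NS[of z p] p(1) by auto
      then have "z \<notin> {a, b, e}" using N ab p by auto
      then show "z \<in> {q}" using pq \<open>z \<in> A\<close> \<open>z \<noteq> p\<close> by blast
    qed
    then have "card (nbrs E A p) \<le> 1" using card_mono[of "{q}"] by fastforce
    then show False using two[OF p(1)] by simp
  qed
  have db: "d \<noteq> b" using d c ce NS[OF abe(1,2)] abe by auto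
  have "c \<noteq> d"
  proof
    assume "c = d"
    then have "b \<in> nbrs E A c" "e \<in> nbrs E A c" using c d NS cd abe by auto
    then have N: "nbrs E A c = {b, e}" using pair[OF cd(1), of b] ab(2) by auto
    have "card (A - {a, b, c, e}) = 1" using five a abe ab(2) cd c(2) ce finA by (simp add: card_Diff_subset)
    then obtain p where p: "A - {a, b, c, e} = {p}" using card_1_singletonE by blast
    then have pA: "p \<in> A" "p \<notin> {a, b, c, e}" by auto
    have "z \<notin> nbrs E A p" for z
    proof
      assume z: "z \<in> nbrs E A p"
      then have "z \<in> A" "z \<noteq> p" "p \<in> nbrs E A z" using NA[of p] NS[of z p] pA(1) by auto
      then have "z \<notin> {a, b, c, e}" using N ab c d pA \<open>c = d\<close> by auto
      then show False using p \<open>z \<in> A\<close> \<open>z \<noteq> p\<close> by blast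
    qed
    then have "nbrs E A p = {}" by blast
    then show False using two[OF pA(1)] by simp
  qed
  then have dist: "distinct [a, b, c, d, e]" using ab abe c(2) d(2) cd ce db by auto
  then have "card {a, b, c, d, e} = 5" by auto
  then have A: "A = {a, b, c, d, e}"
    using card_subset_eq[OF finA, of "{a, b, c, d, e}"] five a abe cd by auto
  have "nbrs E A c \<subseteq> {b, d}"
    using NA[of c] A NS[OF a cd(1)] NS[OF abe(2) cd(1)] ab d dist by auto
  then have Nc: "nbrs E A c = {b, d}" using eqI[OF cd(1)] db by blast
  have "nbrs E A d \<subseteq> {c, e}"
    using NA[of d] A NS[OF a cd(2)] NS[OF abe(1) cd(2)] ab c dist by auto
  then have Nd: "nbrs E A d = {c, e}" using eqI[OF cd(2)] ce by blast
  show ?thesis by (rule that[OF dist A ab(1) c(1) Nc Nd d(1)])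
qed

lemma chi_five_regular:
  assumes "five_regular E A"
  shows "chi E A = 3"
proof -
  obtain a b c d e where dist: "distinct [a, b, c, d, e]" and A: "A = {a, b, c, d, e}"
    and N: "nbrs E A a = {b, e}" "nbrs E A b = {a, c}" "nbrs E A c = {b, d}"
    "nbrs E A d = {c, e}" "nbrs E A e = {d, a}"
    using five_regular_cycle[OF assms] .
  have E: "E u v \<longleftrightarrow> v \<in> nbrs E A u" if "v \<in> A" for u v using that by (simp add: nbrs_def)
  have mem: "a \<in> A" "b \<in> A" "c \<in> A" "d \<in> A" "e \<in> A" by (simp_all add: A)
  have "\<not> E a c" "\<not> E b d"
    using E[OF mem(3), of a] E[OF mem(4), of b] dist N by auto
  then have "clique_on (co E) {a, c}" "clique_on (co E) {b, d}" "clique_on (co E) {e}"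
    using sym dist by (auto simp: clique_on_def co_def)
  from this[THEN chi_independent_le]
  have "chi E (({a, c} \<union> {b, d}) \<union> {e}) \<le> 3"
    using chi_Un_le[of "{a, c} \<union> {b, d}" "{e}"] chi_Un_le[of "{a, c}" "{b, d}"] by simp
  moreover have "({a, c} \<union> {b, d}) \<union> {e} = A" unfolding A by auto
  moreover have "3 \<le> chi E A"
  proof (rule ccontr)
    assume "\<not> ?thesis"
    then have less: "n < 2" if "n < chi E A" for n using that by simp
    obtain f :: "'a \<Rightarrow> nat" where f: "proper E A f" "f ` A \<subseteq> {..<chi E A}"
      using chi_colouring[of A] A by auto
    have "f v < 2" if "v \<in> A" for v using less f(2) that by blast
    then have lt: "f a < 2" "f b < 2" "f c < 2" "f d < 2" "f e < 2" by (simp_all add: A)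
    have "E a b" "E b c" "E c d" "E d e" "E e a" using E mem N by simp_all
    then have "f a \<noteq> f b" "f b \<noteq> f c" "f c \<noteq> f d" "f d \<noteq> f e" "f e \<noteq> f a"
      using f(1) mem unfolding proper_def by blast+
    then show False using lt by linarith
  qed
  ultimately show ?thesis by simp
qed

lemma NG_partition_co:
  assumes "NG_partition E A B C"
  shows "NG_partition (co E) A C B"
  using assms five_regular_co[of A] unfolding NG_partition_def co_co
  by (auto simp: co_def)

text \<open>The vertices of \<open>C\<close> see only \<open>B\<close> and each other, and \<open>C\<close> is independent, so they can reuse a colour
from \<open>A\<close>.\<close>

lemma chi_NG_partition:
  assumes fin: "finite (A \<union> B \<union> C)" and P: "NG_partition E A B C"
  shows "chi E (A \<union> B \<union> C) = chi E A + card B"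
proof -
  have finAB: "finite A" "finite B" "finite (A \<union> B)" using fin by auto
  have join: "chi E (A \<union> B) = chi E A + card B"
    using chi_join[OF finAB(1,2)] chi_clique[OF finAB(2)] P by (simp add: NG_partition_def)
  have "chi E (A \<union> B \<union> C) \<le> chi E (A \<union> B)"
  proof -
    obtain c :: "'a \<Rightarrow> nat" where c: "proper E (A \<union> B) c" "c ` (A \<union> B) \<subseteq> {..<chi E (A \<union> B)}"
      using chi_colouring[OF finAB(3)] .
    obtain a where a: "a \<in> A" using P by (auto simp: NG_partition_def)
    \<comment> \<open>All of \<open>C\<close> receives the colour of one vertex of \<open>A\<close>, which does not occur on \<open>B\<close>.\<close>
    let ?c = "\<lambda>v. if v \<in> A \<union> B then c v else c a"
    have "?c u \<noteq> ?c v" if uv: "u \<in> A \<union> B \<union> C" "v \<in> A \<union> B \<union> C" "E u v" for u v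
    proof -
      have *: "?c u \<noteq> ?c v" if "u \<in> A \<union> B" "v \<in> C" "v \<notin> A \<union> B" "E u v" for u v
      proof -
        have "u \<in> B" using P that unfolding NG_partition_def by blast
        then have "E u a" using P a sym unfolding NG_partition_def by blast
        then show ?thesis using c(1) a \<open>u \<in> B\<close> that by (auto simp: proper_def)
      qed
      have "u \<in> A \<union> B \<or> v \<in> A \<union> B"
      proof (rule ccontr)
        assume "\<not> ?thesis"
        then have "u \<in> C" "v \<in> C" using uv by auto
        moreover have "u \<noteq> v" using uv(3) irrefl by metis
        ultimately have "co E u v" using P unfolding NG_partition_def clique_on_def by blast
        then show False using uv(3) by (simp add: co_def)
      qed
      then consider "u \<in> A \<union> B" "v \<in> A \<union> B" | "u \<in> A \<union> B" "v \<notin> A \<union> B" | "v \<in> A \<union> B" "u \<notin> A \<union> B"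
        by blast
      then show ?thesis
      proof cases
        case 1
        then show ?thesis using c(1) uv(3) unfolding proper_def by (simp only: if_True) blast
      next
        case 2
        then show ?thesis using *[of u v] uv by blast
      next
        case 3
        then show ?thesis using *[of v u] uv sym[OF uv(3)] by fastforce
      qed
    qed
    then have "proper E (A \<union> B \<union> C) ?c" unfolding proper_def by blast
    then have "chi E (A \<union> B \<union> C) \<le> card {..<chi E (A \<union> B)}"
      by (rule chi_le_card_colours) (use c(2) a in auto)
    then show ?thesis by simp
  qed
  moreover have "chi E (A \<union> B) \<le> chi E (A \<union> B \<union> C)" by (rule chi_mono[OF fin]) auto
  ultimately show ?thesis using join by simp
qed

text \<open>Each of the three shapes of \<open>A\<close> attains the Nordhaus--Gaddum bound, and the contributions of \<open>B\<close>
and \<open>C\<close> add up.\<close>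

lemma NG_partition_extremal:
  assumes fin: "finite (A \<union> B \<union> C)" and P: "NG_partition E A B C"
  shows "chi E (A \<union> B \<union> C) + chi (co E) (A \<union> B \<union> C) = Suc (card (A \<union> B \<union> C))"
proof -
  interpret co: adjacency "co E" by (rule adjacency_co)
  have fins: "finite A" "finite B" "finite C" using fin by auto
  have "A \<union> C \<union> B = A \<union> B \<union> C" by auto
  then have "chi (co E) (A \<union> B \<union> C) = chi (co E) A + card C"
    using co.chi_NG_partition[OF _ NG_partition_co[OF P]] fin by simp
  moreover note chi_NG_partition[OF fin P]
  moreover have "card (A \<union> B \<union> C) = card A + card B + card C"
    using fins P by (simp add: NG_partition_def card_Un_disjoint Int_Un_distrib2)
  moreover have "chi E A + chi (co E) A = Suc (card A)"
  proof -
    have pos: "0 < chi E A" "0 < chi (co E) A"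
      using chi_pos co.chi_pos fins(1) P by (auto simp: NG_partition_def)
    consider "clique_on E A" | "clique_on (co E) A" | "five_regular E A"
      using P by (auto simp: NG_partition_def)
    then show ?thesis
    proof cases
      case 1
      then show ?thesis using chi_clique[OF fins(1)] chi_co_clique_le pos by fastforce
    next
      case 2
      then show ?thesis using co.chi_clique[OF fins(1)] chi_independent_le pos by fastforce
    next
      case 3
      then show ?thesis using chi_five_regular co.chi_five_regular[OF five_regular_co]
        by (simp add: five_regular_def)
    qed
  qed
  ultimately show ?thesis by linarith
qed

end

context extremal_parts
begin

lemma finite_parts: "finite A" "finite B" "finite C"
  using fin unfolding V by auto

lemma card_V: "card V = card A + card B + card C"
  using finite_parts disj unfolding V by (simp add: card_Un_disjoint Int_Un_distrib2)

lemma NG_V: "chi E V + chi (co E) V = Suc (card V)"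
  using chi_V chi_co_V NG_A card_V by simp

lemma extremal_parts_co: "extremal_parts (co E) V A C B"
proof -
  interpret co: adjacency "co E" by (rule adjacency_co)
  have "Suc (deg (co E) V a) = chi (co E) V" if "a \<in> A" for a
    using deg_co[OF fin, of a] deg_A[OF that] NG_V that V by auto
  then show ?thesis
    by unfold_locales
      (use fin V disj ne B C AB AC chi_V chi_co_V NG_A irrefl in \<open>auto simp: co_co\<close>, auto simp: co_def)
qed

lemma shape_A: "clique_on E A \<or> clique_on (co E) A \<or> five_regular E A"
proof -
  interpret co: adjacency "co E" by (rule adjacency_co)
  have pos: "0 < chi E A" "0 < chi (co E) A"
    using chi_pos co.chi_pos finite_parts(1) ne by auto
  interpret regular_extremal E A "chi E A - 1" "chi (co E) A - 1"
  proof
    fix a assume a: "a \<in> A"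
    have "nbrs E V a = nbrs E A a \<union> B" using a AB AC unfolding V by (auto simp: nbrs_def)
    moreover have "nbrs E A a \<inter> B = {}" using disj by (auto simp: nbrs_def)
    ultimately have "deg E V a = deg E A a + card B"
      using finite_parts by (simp add: card_Un_disjoint finite_nbrs)
    then show "deg E A a = chi E A - 1" using deg_A[OF a] chi_V by simp
  qed (use pos NG_A finite_parts in auto)
  show ?thesis using regular_extremal_shape by (simp add: five_regular_def)
qed

text \<open>The vertex \<open>b\<close> is adjacent to the rest of \<open>A \<union> B\<close>, and \<open>|A| + |B| \<ge> \<chi>(G)\<close> because \<open>\<chi>(G[A]) \<le> |A|\<close>. If
its degree is as small as \<open>\<chi>(G) - 1\<close>, both estimates are equalities.\<close>

lemma deg_B:
  assumes "b \<in> B"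
  shows "chi E V \<le> Suc (deg E V b)" and "Suc (deg E V b) = chi E V \<Longrightarrow> clique_on E A \<and> nbrs E V b \<inter> C = {}"
proof -
  have sub: "A \<union> (B - {b}) \<subseteq> nbrs E V b"
    using assms AB B sym V by (auto simp: nbrs_def clique_on_def)
  have card: "Suc (card (A \<union> (B - {b}))) = card A + card B"
    using finite_parts disj assms card_Suc_Diff1[of B b]
    by (subst card_Un_disjoint) auto
  have le: "card A + card B \<le> Suc (deg E V b)"
    using card_mono[OF finite_nbrs[OF fin] sub] card by simp
  then show "chi E V \<le> Suc (deg E V b)" using chi_V chi_le_card[OF finite_parts(1)] by simp
  assume eq: "Suc (deg E V b) = chi E V"
  then have "chi E A = card A" using le chi_V chi_le_card[OF finite_parts(1)] by simp
  moreover from this have "nbrs E V b = A \<union> (B - {b})"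
    using card_subset_eq[OF finite_nbrs[OF fin] sub] card eq chi_V by simp
  ultimately show "clique_on E A \<and> nbrs E V b \<inter> C = {}"
    using chi_eq_card_imp_clique[OF finite_parts(1)] disj by auto
qed

lemma deg_C:
  assumes "c \<in> C"
  shows "Suc (deg E V c) \<le> chi E V" and "Suc (deg E V c) = chi E V \<Longrightarrow> B \<subseteq> nbrs E V c"
proof -
  interpret co: extremal_parts "co E" V A C B by (rule extremal_parts_co)
  have c: "c \<in> V" using assms V by auto
  have sum: "Suc (deg E V c) + Suc (deg (co E) V c) = chi E V + chi (co E) V"
    using deg_co[OF fin c] NG_V by simp
  then show "Suc (deg E V c) \<le> chi E V" using co.deg_B(1)[OF assms] by simp
  assume "Suc (deg E V c) = chi E V"
  then have "nbrs (co E) V c \<inter> B = {}" using co.deg_B(2)[OF assms] sum by simp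
  then show "B \<subseteq> nbrs E V c" using V disj assms by (auto simp: nbrs_def co_def)
qed

text \<open>The vertices of \<open>B\<close> of degree \<open>\<chi>(G) - 1\<close> move to \<open>A\<close>. If there are any, \<open>A \<union> B\<close> is a clique, so the
enlarged class is still joined to what remains of \<open>B\<close>.\<close>

lemma NG_partition_by_degree_if:
  assumes "\<And>c. c \<in> C \<Longrightarrow> Suc (deg E V c) \<noteq> chi E V"
  shows "NG_partition E {v \<in> V. Suc (deg E V v) = chi E V} {v \<in> V. chi E V < Suc (deg E V v)}
    {v \<in> V. Suc (deg E V v) < chi E V}"
proof -
  define B' where "B' = {b \<in> B. Suc (deg E V b) = chi E V}"
  have sets: "{v \<in> V. Suc (deg E V v) = chi E V} = A \<union> B'"
    "{v \<in> V. chi E V < Suc (deg E V v)} = B - B'" "{v \<in> V. Suc (deg E V v) < chi E V} = C"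
    using deg_A deg_B(1) deg_C(1) assms disj unfolding V B'_def by (force simp: less_le)+
  have B': "B' \<subseteq> B" by (auto simp: B'_def)
  have "clique_on E (A \<union> B')" if "B' \<noteq> {}"
    using that deg_B(2) B B' AB sym unfolding clique_on_def B'_def by blast
  moreover have "\<not> E b c" if "b \<in> B'" "c \<in> C" for b c
    using deg_B(2)[of b] that V by (auto simp: B'_def nbrs_def)
  moreover have "E b x" if "b \<in> B'" "x \<in> B - B'" for b x
    using that B B' unfolding clique_on_def by (metis DiffD1 DiffD2 subsetD)
  ultimately show ?thesis
    unfolding sets NG_partition_def
    using ne disj shape_A B B' C AB AC
    by (cases "B' = {}") (auto simp: clique_on_def)
qed

text \<open>If some \<open>c\<close> in \<open>C\<close> has degree \<open>\<chi>(G) - 1\<close>, it is adjacent to all of \<open>B\<close>, while a vertex of \<open>B\<close> of this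
degree would have no neighbour in \<open>C\<close>. So the case treated before applies to the complement.\<close>

lemma NG_partition_by_degree:
  "NG_partition E {v \<in> V. Suc (deg E V v) = chi E V} {v \<in> V. chi E V < Suc (deg E V v)}
    {v \<in> V. Suc (deg E V v) < chi E V}"
proof (cases "\<exists>c\<in>C. Suc (deg E V c) = chi E V")
  case False
  then show ?thesis using NG_partition_by_degree_if by blast
next
  case True
  then obtain c where c: "c \<in> C" "Suc (deg E V c) = chi E V" by blast
  interpret co: extremal_parts "co E" V A C B by (rule extremal_parts_co)
  have sum: "Suc (deg E V v) + Suc (deg (co E) V v) = chi E V + chi (co E) V" if "v \<in> V" for v
    using deg_co[OF fin that] NG_V by simp
  have noB: "Suc (deg (co E) V b) \<noteq> chi (co E) V" if b: "b \<in> B" for b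
  proof
    assume "Suc (deg (co E) V b) = chi (co E) V"
    then have "Suc (deg E V b) = chi E V" using sum[of b] b V by auto
    then have "c \<notin> nbrs E V b" using deg_B(2)[OF b] c(1) by blast
    moreover have "b \<in> nbrs E V c" using deg_C(2)[OF c] b by blast
    ultimately show False using c(1) V sym by (auto simp: nbrs_def)
  qed
  have flip: "Suc (deg (co E) V v) = chi (co E) V \<longleftrightarrow> Suc (deg E V v) = chi E V"
    "chi (co E) V < Suc (deg (co E) V v) \<longleftrightarrow> Suc (deg E V v) < chi E V"
    "Suc (deg (co E) V v) < chi (co E) V \<longleftrightarrow> chi E V < Suc (deg E V v)" if "v \<in> V" for v
    using sum[OF that] by (safe; linarith)+
  then have sets:
    "{v \<in> V. Suc (deg (co E) V v) = chi (co E) V} = {v \<in> V. Suc (deg E V v) = chi E V}"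
    "{v \<in> V. chi (co E) V < Suc (deg (co E) V v)} = {v \<in> V. Suc (deg E V v) < chi E V}"
    "{v \<in> V. Suc (deg (co E) V v) < chi (co E) V} = {v \<in> V. chi E V < Suc (deg E V v)}"
    by blast+
  have "NG_partition (co E) {v \<in> V. Suc (deg E V v) = chi E V} {v \<in> V. Suc (deg E V v) < chi E V}
    {v \<in> V. chi E V < Suc (deg E V v)}"
    using co.NG_partition_by_degree_if[OF noB] unfolding sets .
  from co.NG_partition_co[OF this] show ?thesis unfolding co_co .
qed

end


section \<open>Correctness of the algorithm\<close>

definition adj :: "'a ugraph \<Rightarrow> 'a \<Rightarrow> 'a \<Rightarrow> bool" where
  "adj G u v \<longleftrightarrow> {u, v} \<in> edges G"

lemma edge_cases:
  assumes "simple_graph G" "e \<in> edges G"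
  obtains u v where "e = {u, v}" "u \<noteq> v" "u \<in> verts G" "v \<in> verts G"
proof -
  have "e \<subseteq> verts G" "card e = 2" using assms by (auto simp: simple_graph_def nsets_def)
  then show ?thesis using that by (auto simp: card_2_iff)
qed

lemma adjacency_adj:
  assumes "simple_graph G"
  shows "adjacency (adj G)"
proof
  show "adj G u v \<Longrightarrow> adj G v u" for u v by (simp add: adj_def insert_commute)
  show "\<not> adj G v v" for v
    using assms by (auto simp: adj_def simple_graph_def nsets_def)
qed

lemma chromatic_number_eq_chi: "chromatic_number G = chi (adj G) (verts G)"
  by (simp add: chromatic_number_def colorable_def chi_def proper_def adj_def image_subset_iff
      conj_commute)

lemma chromatic_number_complement: "chromatic_number (complement G) = chi (co (adj G)) (verts G)"
proof -
  have "{u, v} \<in> edges (complement G) \<longleftrightarrow> co (adj G) u v" if "u \<in> verts G" "v \<in> verts G" for u v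
    using that by (auto simp: complement_def nsets_def co_def adj_def card_2_iff)
  then show ?thesis
    by (simp add: chromatic_number_def colorable_def chi_def proper_def image_subset_iff
        complement_def conj_commute)
qed

lemma vertex_degree_eq_deg: "vertex_degree G v = deg (adj G) (verts G) v"
  by (simp add: vertex_degree_def nbrs_def adj_def)

lemma complete_induced: "complete_graph (induced G A) \<longleftrightarrow> clique_on (adj G) A"
  by (auto simp: complete_graph_def induced_def clique_def clique_on_def adj_def)

lemma independent_induced: "independent_graph (induced G A) \<longleftrightarrow> clique_on (co (adj G)) A"
  by (auto simp: independent_graph_def induced_def indep_def clique_on_def co_def adj_def)

lemma five_cycle_induced:
  assumes G: "simple_graph G"
  shows "five_cycle (induced G A) \<longleftrightarrow> five_regular (adj G) A"
proof
  assume "five_cycle (induced G A)"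
  then obtain a b c d e where dist: "distinct [a, b, c, d, e]" and A: "A = {a, b, c, d, e}"
    and ed: "{x \<in> edges G. x \<subseteq> A} = {{a, b}, {b, c}, {c, d}, {d, e}, {e, a}}"
    by (auto simp: five_cycle_def induced_def)
  have N: "nbrs (adj G) A v = {u \<in> A. {v, u} \<in> {{a, b}, {b, c}, {c, d}, {d, e}, {e, a}}}"
    if "v \<in> A" for v
    unfolding ed[symmetric] using that by (auto simp: nbrs_def adj_def)
  have "nbrs (adj G) A a = {b, e}" "nbrs (adj G) A b = {a, c}" "nbrs (adj G) A c = {b, d}"
    "nbrs (adj G) A d = {c, e}" "nbrs (adj G) A e = {d, a}"
    using dist by (subst N; auto simp: A doubleton_eq_iff)+
  moreover have "card A = 5" using dist by (auto simp: A)
  ultimately show "five_regular (adj G) A" using dist unfolding five_regular_def by (auto simp: A)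
next
  interpret adjacency "adj G" by (rule adjacency_adj[OF G])
  assume "five_regular (adj G) A"
  then obtain a b c d e where dist: "distinct [a, b, c, d, e]" and A: "A = {a, b, c, d, e}"
    and N: "nbrs (adj G) A a = {b, e}" "nbrs (adj G) A b = {a, c}" "nbrs (adj G) A c = {b, d}"
    "nbrs (adj G) A d = {c, e}" "nbrs (adj G) A e = {d, a}"
    using five_regular_cycle by metis
  have E: "{u, v} \<in> edges G \<longleftrightarrow> v \<in> nbrs (adj G) A u" if "v \<in> A" for u v
    using that by (simp add: nbrs_def adj_def)
  have mem: "a \<in> A" "b \<in> A" "c \<in> A" "d \<in> A" "e \<in> A" by (simp_all add: A)
  have "{x \<in> edges G. x \<subseteq> A} = {{a, b}, {b, c}, {c, d}, {d, e}, {e, a}}"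
  proof
    show "{{a, b}, {b, c}, {c, d}, {d, e}, {e, a}} \<subseteq> {x \<in> edges G. x \<subseteq> A}"
      using E mem N by auto
    show "{x \<in> edges G. x \<subseteq> A} \<subseteq> {{a, b}, {b, c}, {c, d}, {d, e}, {e, a}}"
    proof
      fix x assume x: "x \<in> {x \<in> edges G. x \<subseteq> A}"
      then have xG: "x \<in> edges G" and xA: "x \<subseteq> A" by auto
      obtain u v where uv: "x = {u, v}" using edge_cases[OF G xG] .
      then have v: "v \<in> nbrs (adj G) A u" and u: "u \<in> {a, b, c, d, e}"
        using xG xA E[of v u] by (simp_all add: A[symmetric])
      have "{u, v} \<in> {{a, b}, {b, c}, {c, d}, {d, e}, {e, a}}"
        using u v N by (elim insertE emptyE) (auto simp: doubleton_eq_iff)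
      then show "x \<in> {{a, b}, {b, c}, {c, d}, {d, e}, {e, a}}" unfolding uv .
    qed
  qed
  then show "five_cycle (induced G A)"
    unfolding five_cycle_def using dist A
    by (intro exI[of _ a] exI[of _ b] exI[of _ c] exI[of _ d] exI[of _ e]) (simp add: induced_def)
qed

text \<open>Given the answers to (i) to (v), check (vi) compares \<open>k\<close> with \<open>|B| + \<chi>(G[A])\<close>, the chromatic number.\<close>

theorem NG_check_iff:
  assumes G: "simple_graph G" and k: "k \<ge> 1"
  shows "NG_check G k \<longleftrightarrow> NG_graph G \<and> chromatic_number G = k"
proof -
  let ?E = "adj G" and ?V = "verts G"
  interpret adjacency ?E by (rule adjacency_adj[OF G])
  have fin: "finite ?V" using G by (simp add: simple_graph_def)
  define A B C where "A = {v \<in> ?V. Suc (deg ?E ?V v) = k}"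
    and "B = {v \<in> ?V. k < Suc (deg ?E ?V v)}" and "C = {v \<in> ?V. Suc (deg ?E ?V v) < k}"
  have sets: "{v \<in> ?V. vertex_degree G v = k - 1} = A" "{v \<in> ?V. vertex_degree G v > k - 1} = B"
    "{v \<in> ?V. vertex_degree G v < k - 1} = C"
    using k by (auto simp: A_def B_def C_def vertex_degree_eq_deg)
  have V: "A \<union> B \<union> C = ?V" and disj: "A \<inter> B = {}" "A \<inter> C = {}" "B \<inter> C = {}"
    by (auto simp: A_def B_def C_def)
  have finA: "finite A" using fin by (simp add: A_def)
  have check: "NG_check G k \<longleftrightarrow> NG_partition ?E A B C \<and>
      (clique_on ?E A \<longrightarrow> card A + card B = k) \<and> (clique_on (co ?E) A \<longrightarrow> card B + 1 = k) \<and>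
      (five_regular ?E A \<longrightarrow> card B + 3 = k)"
    unfolding NG_check_def Let_def sets complete_induced independent_induced five_cycle_induced[OF G]
      NG_partition_def
    using disj by (auto simp: adj_def)
  have chi: "chi ?E ?V = chi ?E A + card B" if "NG_partition ?E A B C"
    using chi_NG_partition[OF _ that] fin unfolding V by blast
  have chiA: "clique_on ?E A \<Longrightarrow> chi ?E A = card A" "five_regular ?E A \<Longrightarrow> chi ?E A = 3"
    "clique_on (co ?E) A \<Longrightarrow> A \<noteq> {} \<Longrightarrow> chi ?E A = 1"
    using chi_clique[OF finA] chi_five_regular chi_independent_le[of A] chi_pos[OF finA] by auto
  have NG: "NG_graph G \<longleftrightarrow> chi ?E ?V + chi (co ?E) ?V = Suc (card ?V)"
    unfolding NG_graph_def chromatic_number_complement chromatic_number_eq_chi[of G] by simp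
  show ?thesis
  proof
    assume c: "NG_check G k"
    then have P: "NG_partition ?E A B C" by (simp add: check)
    have "NG_graph G" using NG_partition_extremal[OF _ P] fin unfolding V NG by blast
    moreover have "chi ?E ?V = k"
      using c chi[OF P] chiA P unfolding check NG_partition_def by auto
    ultimately show "NG_graph G \<and> chromatic_number G = k" by (simp add: chromatic_number_eq_chi)
  next
    assume "NG_graph G \<and> chromatic_number G = k"
    then have ng: "chi ?E ?V + chi (co ?E) ?V = Suc (card ?V)" and k': "chi ?E ?V = k"
      by (auto simp: NG chromatic_number_eq_chi)
    obtain A0 B0 C0 where "extremal_parts ?E ?V A0 B0 C0" using extremal_parts_exist[OF fin ng] .
    from extremal_parts.NG_partition_by_degree[OF this]
    have P: "NG_partition ?E A B C" unfolding k' A_def B_def C_def .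
    then show "NG_check G k"
      using chi[OF P] chiA k' unfolding check NG_partition_def by auto
  qed
qed

theorem algorithm_NG_correct:
  assumes G: "simple_graph G"
  shows "algorithm_NG G = (if NG_graph G then Some (chromatic_number G) else None)"
proof -
  interpret adjacency "adj G" by (rule adjacency_adj[OF G])
  interpret co: adjacency "co (adj G)" by (rule adjacency_co)
  have fin: "finite (verts G)" using G by (simp add: simple_graph_def)
  have bounds: "chromatic_number G \<le> card (verts G)" "chromatic_number (complement G) \<le> card (verts G)"
    using chi_le_card[OF fin] co.chi_le_card[OF fin]
    unfolding chromatic_number_complement chromatic_number_eq_chi[of G] .
  show ?thesis
  proof (cases "NG_graph G")
    case True
    then have k: "chromatic_number G \<in> set [1..<Suc (card (verts G))]"
      using bounds by (auto simp: NG_graph_def)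
    have "find (NG_check G) [1..<Suc (card (verts G))] =
      find (\<lambda>k. k = chromatic_number G) [1..<Suc (card (verts G))]"
      by (rule find_cong) (use True NG_check_iff[OF G] in auto)
    also have "\<dots> = Some (chromatic_number G)"
    proof -
      have "find (\<lambda>k. k = x) xs = Some x" if "x \<in> set xs" for x and xs :: "nat list"
        using that by (induction xs) auto
      then show ?thesis using k by blast
    qed
    finally show ?thesis using True by (simp add: algorithm_NG_def)
  next
    case False
    have "find (NG_check G) [1..<Suc (card (verts G))] = None"
      using False NG_check_iff[OF G] by (auto simp: find_None_iff)
    then show ?thesis using False by (simp add: algorithm_NG_def)
  qed
qed


section \<open>Total correctness with time bounds\<close>

primrec loop_free :: "'v com \<Rightarrow> bool" where
  "loop_free Skip \<longleftrightarrow> True"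
| "loop_free (x ::= e) \<longleftrightarrow> True"
| "loop_free (Store x i e) \<longleftrightarrow> True"
| "loop_free (c1 ;; c2) \<longleftrightarrow> loop_free c1 \<and> loop_free c2"
| "loop_free (Cond b c1 c2) \<longleftrightarrow> loop_free c1 \<and> loop_free c2"
| "loop_free (While b c) \<longleftrightarrow> False"

text \<open>The effect of loop-free code; the value on loops is a dummy.\<close>

primrec step :: "matrix \<Rightarrow> 'v com \<Rightarrow> 'v state \<Rightarrow> 'v state" where
  "step M Skip s = s"
| "step M (x ::= e) s = ((fst s)(x := aval e s), snd s)"
| "step M (Store x i e) s = (fst s, (snd s)(x := (snd s x)(aval i s := aval e s)))"
| "step M (c1 ;; c2) s = step M c2 (step M c1 s)"
| "step M (Cond b c1 c2) s = (if bval M b s then step M c1 s else step M c2 s)"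
| "step M (While b c) s = s"

primrec max_cost :: "'v com \<Rightarrow> nat" where
  "max_cost Skip = 1"
| "max_cost (x ::= e) = 1 + acost e"
| "max_cost (Store x i e) = 1 + acost i + acost e"
| "max_cost (c1 ;; c2) = max_cost c1 + max_cost c2"
| "max_cost (Cond b c1 c2) = 1 + bcost b + max (max_cost c1) (max_cost c2)"
| "max_cost (While b c) = 0"

text \<open>Total correctness with a time bound. As programs are deterministic, one halting run is the only one.\<close>

definition halts_within ::
    "matrix \<Rightarrow> 'v com \<Rightarrow> 'v state \<Rightarrow> nat \<Rightarrow> ('v state \<Rightarrow> bool) \<Rightarrow> bool" where
  "halts_within M c s T Q \<longleftrightarrow> (\<exists>t s'. run M c s t s' \<and> t \<le> T \<and> Q s')"

lemma run_loop_free: "loop_free c \<Longrightarrow> \<exists>t \<le> max_cost c. run M c s t (step M c s)"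
proof (induction c arbitrary: s)
  case (Seq c1 c2)
  then obtain t1 t2 where "t1 \<le> max_cost c1" "run M c1 s t1 (step M c1 s)"
    "t2 \<le> max_cost c2" "run M c2 (step M c1 s) t2 (step M c2 (step M c1 s))"
    by (metis loop_free.simps(4))
  then show ?case by (auto intro!: exI[of _ "t1 + t2"] run_Seq)
next
  case (Cond b c1 c2)
  show ?case
  proof (cases "bval M b s")
    case True
    then obtain t where "t \<le> max_cost c1" "run M c1 s t (step M c1 s)" using Cond by fastforce
    then show ?thesis using run_Cond_True[OF True, of c1 t "step M c1 s" c2] True
      by (intro exI[of _ "1 + bcost b + t"]) simp
  next
    case False
    then obtain t where "t \<le> max_cost c2" "run M c2 s t (step M c2 s)" using Cond by fastforce
    then show ?thesis using run_Cond_False[OF False, of c2 t "step M c2 s" c1] False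
      by (intro exI[of _ "1 + bcost b + t"]) simp
  qed
next
  case Skip
  show ?case by (metis run_Skip step.simps(1) max_cost.simps(1) order_refl)
next
  case (Assign x e)
  show ?case by (metis run_Assign step.simps(2) max_cost.simps(2) order_refl)
next
  case (Store x i e)
  show ?case by (metis run_Store step.simps(3) max_cost.simps(3) order_refl)
qed simp

lemma halts_loop_free:
  assumes "loop_free c" "Q (step M c s)"
  shows "halts_within M c s (max_cost c) Q"
  using run_loop_free[OF assms(1), of M s] assms(2) unfolding halts_within_def by blast

lemma halts_Seq:
  assumes "halts_within M c1 s T1 Q1" "\<And>s'. Q1 s' \<Longrightarrow> halts_within M c2 s' T2 Q"
  shows "halts_within M (c1 ;; c2) s (T1 + T2) Q"
  using assms unfolding halts_within_def by (meson add_mono run_Seq)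

lemma halts_loop_free_Seq:
  assumes "loop_free c1" "halts_within M c2 (step M c1 s) T Q"
  shows "halts_within M (c1 ;; c2) s (max_cost c1 + T) Q"
  by (rule halts_Seq[OF halts_loop_free[where Q = "\<lambda>s'. s' = step M c1 s"]]) (use assms in auto)

lemma halts_mono:
  assumes "halts_within M c s T Q" "T \<le> T'" "\<And>s'. Q s' \<Longrightarrow> Q' s'"
  shows "halts_within M c s T' Q'"
  using assms unfolding halts_within_def by (meson order_trans)

lemma halts_While_False:
  assumes "\<not> bval M b s" "Q s"
  shows "halts_within M (While b c) s (1 + bcost b) Q"
  using run_While_False[OF assms(1)] assms(2) unfolding halts_within_def by blast

lemma halts_While_True:
  assumes "bval M b s" "halts_within M c s T1 Q1"
    "\<And>s'. Q1 s' \<Longrightarrow> halts_within M (While b c) s' T2 Q"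
  shows "halts_within M (While b c) s (1 + bcost b + T1 + T2) Q"
proof -
  obtain t1 s1 where 1: "run M c s t1 s1" "t1 \<le> T1" "Q1 s1"
    using assms(2) unfolding halts_within_def by blast
  obtain t2 s2 where 2: "run M (While b c) s1 t2 s2" "t2 \<le> T2" "Q s2"
    using assms(3)[OF 1(3)] unfolding halts_within_def by blast
  have "1 + bcost b + t1 + t2 \<le> 1 + bcost b + T1 + T2" using 1 2 by linarith
  then show ?thesis
    using run_While_True[OF assms(1) 1(1) 2(1)] 2(3) unfolding halts_within_def by blast
qed

text \<open>Two units initialise the counter, four evaluate the failing test, and each round costs eight units
on top of the body: four for the test and four for the increment.\<close>

definition for_time :: "nat \<Rightarrow> nat \<Rightarrow> nat" where
  "for_time T n = 6 + n * (T + 8)"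

text \<open>The invariant speaks of the state in which the counter has just been set, hence the update by
\<open>Suc i\<close> in the premise on the body.\<close>

lemma halts_For:
  assumes init: "I 0 ((fst s)(x := 0), snd s)"
    and inv: "\<And>i s. I i s \<Longrightarrow> fst s x = i \<and> fst s y = n"
    and body: "\<And>i s. i < n \<Longrightarrow> I i s \<Longrightarrow>
      halts_within M c s T (\<lambda>s'. I (Suc i) ((fst s')(x := Suc i), snd s') \<and> fst s' x = i)"
  shows "halts_within M (For x (Reg y) c) s (for_time T n) (I n)"
proof -
  let ?w = "While (Less (Reg x) (Reg y)) (c ;; x ::= Plus (Reg x) (Num 1))"
  have loop: "halts_within M ?w s (4 + m * (T + 8)) (I n)"
    if "m = n - i" "i \<le> n" "I i s" for m i s
    using that
  proof (induction m arbitrary: i s)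
    case 0
    then have "i = n" by simp
    show ?case
      by (rule halts_mono[OF halts_While_False[where Q = "I n"]])
        (use inv[OF 0(3)] 0(3) \<open>i = n\<close> in auto)
  next
    case (Suc m)
    then have i: "i < n" "m = n - Suc i" by simp_all
    have "halts_within M (c ;; x ::= Plus (Reg x) (Num 1)) s (T + 4) (I (Suc i))"
    proof (rule halts_Seq[OF body[OF i(1) Suc.prems(3)]])
      fix s' assume *: "I (Suc i) ((fst s')(x := Suc i), snd s') \<and> fst s' x = i"
      show "halts_within M (x ::= Plus (Reg x) (Num 1)) s' 4 (I (Suc i))"
        by (rule halts_mono[OF halts_loop_free[where Q = "I (Suc i)"]]) (use * in auto)
    qed
    from halts_While_True[OF _ this, of "Less (Reg x) (Reg y)" "4 + m * (T + 8)" "I n"]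
    have "halts_within M ?w s (1 + bcost (Less (Reg x) (Reg y)) + (T + 4) + (4 + m * (T + 8))) (I n)"
      using inv[OF Suc.prems(3)] i(1) Suc.IH[OF i(2)] by simp
    then show ?case by (rule halts_mono) simp_all
  qed
  have "halts_within M (x ::= Num 0) s 2 (I 0)"
    by (rule halts_mono[OF halts_loop_free[where Q = "I 0"]]) (use init in auto)
  then have "halts_within M (x ::= Num 0 ;; ?w) s (2 + (4 + n * (T + 8))) (I n)"
    by (rule halts_Seq) (rule loop, simp_all)
  then show ?thesis unfolding For_def for_time_def by (rule halts_mono) simp_all
qed


section \<open>Computing degrees and inspecting one partition\<close>

lemma card_less_Suc: "card {v. v < Suc j \<and> P v} = card {v. v < j \<and> P v} + of_bool (P j)"
proof -
  have "{v. v < Suc j \<and> P v} = (if P j then insert j {v. v < j \<and> P v} else {v. v < j \<and> P v})"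
    by (auto simp: less_Suc_eq)
  then show ?thesis by simp
qed

definition degree_body :: "reg com" where
  "degree_body = When (Adj (Reg Xu) (Reg Xv)) (Store Xdeg (Reg Xu) (Plus (Load Xdeg (Reg Xu)) (Num 1)))"

definition degree_time :: "nat \<Rightarrow> nat" where
  "degree_time n = for_time (max_cost (Store Xdeg (Reg Xu) (Num 0) :: reg com) + for_time (max_cost degree_body) n) n"

lemma halts_compute_degrees:
  assumes n: "fst s Xn = n"
  shows "halts_within M compute_degrees s (degree_time n)
    (\<lambda>s'. fst s' Xn = n \<and> (\<forall>u<n. snd s' Xdeg u = card {v. v < n \<and> M u v}))"
proof -
  let ?I = "\<lambda>i s :: reg state. fst s Xu = i \<and> fst s Xn = n \<and> (\<forall>u<i. snd s Xdeg u = card {v. v < n \<and> M u v})"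
  have "halts_within M compute_degrees s (degree_time n) (?I n)"
    unfolding compute_degrees_def degree_body_def[symmetric] degree_time_def
  proof (rule halts_For[where I = ?I])
    fix i s assume i: "i < n" and I: "?I i s"
    let ?s = "step M (Store Xdeg (Reg Xu) (Num 0)) s"
    let ?J = "\<lambda>j s'. fst s' = (fst s)(Xv := j) \<and>
      snd s' Xdeg = (snd s Xdeg)(i := card {v. v < j \<and> M i v})"
    show "halts_within M (Store Xdeg (Reg Xu) (Num 0) ;; For Xv (Reg Xn) degree_body) s
      (max_cost (Store Xdeg (Reg Xu) (Num 0) :: reg com) + for_time (max_cost degree_body) n)
      (\<lambda>s'. ?I (Suc i) ((fst s')(Xu := Suc i), snd s') \<and> fst s' Xu = i)"
    proof (rule halts_Seq[OF halts_loop_free[where Q = "\<lambda>s'. s' = ?s"]])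
      fix s' assume s': "s' = ?s"
      have "halts_within M (For Xv (Reg Xn) degree_body) s' (for_time (max_cost degree_body) n) (?J n)"
      proof (rule halts_For[where I = ?J])
        show "?J 0 ((fst s')(Xv := 0), snd s')" using I by (simp add: s')
        show "?J j t \<Longrightarrow> fst t Xv = j \<and> fst t Xn = n" for j and t :: "reg state" using I by simp
        fix j t assume "j < n" and J: "?J j t"
        show "halts_within M degree_body t (max_cost degree_body)
          (\<lambda>s'. ?J (Suc j) ((fst s')(Xv := Suc j), snd s') \<and> fst s' Xv = j)"
          by (rule halts_loop_free)
            (use I J in \<open>auto simp: degree_body_def card_less_Suc\<close>)
      qed
      then show "halts_within M (For Xv (Reg Xn) degree_body) s' (for_time (max_cost degree_body) n)
        (\<lambda>s'. ?I (Suc i) ((fst s')(Xu := Suc i), snd s') \<and> fst s' Xu = i)"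
        by (rule halts_mono) (use I in \<open>auto simp: less_Suc_eq\<close>)
    qed auto
  qed (use n in auto)
  then show ?thesis by (rule halts_mono) auto
qed

text \<open>The condition on a pair of vertices that the truth value in register \<open>r\<close> quantifies over; \<open>D\<close> is the
array of degrees. Registers that hold no such truth value get the trivial condition, so that a
single equation describes the effect of inspecting a pair on all registers.\<close>

definition pair_ok :: "matrix \<Rightarrow> (nat \<Rightarrow> nat) \<Rightarrow> nat \<Rightarrow> reg \<Rightarrow> nat \<Rightarrow> nat \<Rightarrow> bool" where
  "pair_ok M D k r u v = (case r of
      XindepA \<Rightarrow> \<not> (M u v \<and> D u = k - 1 \<and> D v = k - 1)
    | XindepC \<Rightarrow> \<not> (M u v \<and> D u < k - 1 \<and> D v < k - 1)
    | XnoneAC \<Rightarrow> \<not> (M u v \<and> D u = k - 1 \<and> D v < k - 1)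
    | XcomplA \<Rightarrow> M u v \<or> u = v \<or> \<not> (D u = k - 1 \<and> D v = k - 1)
    | XcomplB \<Rightarrow> M u v \<or> u = v \<or> \<not> (D u > k - 1 \<and> D v > k - 1)
    | XallAB \<Rightarrow> M u v \<or> u = v \<or> \<not> (D u = k - 1 \<and> D v > k - 1)
    | _ \<Rightarrow> True)"

lemma step_When_clear:
  "step M (When b (x ::= Num 0)) s = (\<lambda>r. if r = x \<and> bval M b s then 0 else fst s r, snd s)"
  by (auto simp: fun_eq_iff prod_eq_iff)

lemma step_When_clear_count:
  "x \<noteq> y \<Longrightarrow> step M (When b (x ::= Num 0 ;; y ::= Plus (Reg y) (Num 1))) s =
    (\<lambda>r. if r = x \<and> bval M b s then 0 else if r = y then fst s y + of_bool (bval M b s) else fst s r,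
     snd s)"
  by (auto simp: fun_eq_iff prod_eq_iff)

lemma step_inspect_pair:
  fixes s :: "reg state"
  defines "D \<equiv> snd s Xdeg" and "k \<equiv> fst s Xk" and "u \<equiv> fst s Xu" and "v \<equiv> fst s Xv"
  shows "step M inspect_pair s =
    (\<lambda>r. if r = Xnb then fst s Xnb + of_bool (M u v \<and> D u = k - 1 \<and> D v = k - 1)
         else if pair_ok M D k r u v then fst s r else 0, snd s)"
proof (cases "M u v")
  case True
  then show ?thesis
    unfolding inspect_pair_def step.simps(4) step.simps(5)[of _ "Adj (Reg Xu) (Reg Xv)"]
      step_When_clear step_When_clear_count[of XindepA Xnb, simplified]
    by (intro prod_eqI ext)
      (auto simp: in_A_def in_C_def pair_ok_def D_def k_def u_def v_def split: reg.split)
next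
  case False
  then show ?thesis
    unfolding inspect_pair_def step.simps(4) step.simps(5)[of _ "Adj (Reg Xu) (Reg Xv)"]
      step.simps(5)[of _ "Neg (Eq (Reg Xu) (Reg Xv))"] step_When_clear
    by (intro prod_eqI ext)
      (auto simp: in_A_def in_B_def pair_ok_def D_def k_def u_def v_def split: reg.split)
qed

definition pair_flags :: "reg set" where
  "pair_flags = {XindepA, XindepC, XnoneAC, XcomplA, XcomplB, XallAB}"

lemma pair_ok_other: "r \<notin> pair_flags \<Longrightarrow> pair_ok M D k r u v"
  by (cases r) (auto simp: pair_flags_def pair_ok_def)

lemma halts_inspect_row:
  fixes s :: "reg state"
  assumes n: "fst s Xn = n" and nb: "fst s Xnb = 0"
  defines "D \<equiv> snd s Xdeg" and "k \<equiv> fst s Xk" and "u \<equiv> fst s Xu"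
  shows "halts_within M (For Xv (Reg Xn) inspect_pair) s (for_time (max_cost inspect_pair) n)
    (\<lambda>s'. s' = (\<lambda>r. if r = Xv then n
        else if r = Xnb then card {v. v < n \<and> M u v \<and> D u = k - 1 \<and> D v = k - 1}
        else if \<forall>v<n. pair_ok M D k r u v then fst s r else 0, snd s))"
proof -
  let ?J = "\<lambda>j s'. s' = (\<lambda>r. if r = Xv then j
        else if r = Xnb then card {v. v < j \<and> M u v \<and> D u = k - 1 \<and> D v = k - 1}
        else if \<forall>v<j. pair_ok M D k r u v then fst s r else 0, snd s)"
  show ?thesis
  proof (rule halts_For[where I = ?J])
    show "?J 0 ((fst s)(Xv := 0), snd s)" using nb by (auto simp: fun_eq_iff)
    show "fst t Xv = j \<and> fst t Xn = n" if "?J j t" for j t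
      using that n by (simp add: pair_ok_other pair_flags_def)
    fix j t assume "j < n" and J: "?J j t"
    have ft: "fst t r = (if r = Xv then j
        else if r = Xnb then card {v. v < j \<and> M u v \<and> D u = k - 1 \<and> D v = k - 1}
        else if \<forall>v<j. pair_ok M D k r u v then fst s r else 0)" for r
      using J by simp
    have t: "fst t Xk = k" "fst t Xu = u" "fst t Xv = j" "snd t Xdeg = D" "snd t = snd s"
      using J by (simp_all add: ft pair_ok_other pair_flags_def k_def u_def D_def)
    have "((fst (step M inspect_pair t))(Xv := Suc j)) r = (if r = Xv then Suc j
        else if r = Xnb then card {v. v < Suc j \<and> M u v \<and> D u = k - 1 \<and> D v = k - 1}
        else if \<forall>v<Suc j. pair_ok M D k r u v then fst s r else 0)" for r
      unfolding step_inspect_pair t D_def[symmetric] fst_conv fun_upd_apply ft[of Xnb] ft[of r] card_less_Suc All_less_Suc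
      by auto
    then have "?J (Suc j) ((fst (step M inspect_pair t))(Xv := Suc j), snd (step M inspect_pair t))"
      by (simp add: fun_eq_iff step_inspect_pair t(5))
    moreover have "fst (step M inspect_pair t) Xv = j"
      by (simp add: step_inspect_pair ft pair_ok_other pair_flags_def)
    ultimately show "halts_within M inspect_pair t (max_cost inspect_pair)
      (\<lambda>s'. ?J (Suc j) ((fst s')(Xv := Suc j), snd s') \<and> fst s' Xv = j)"
      by (intro halts_loop_free) (simp_all add: inspect_pair_def)
  qed
qed

text \<open>The code that precedes the inner loop in each round of the outer one, treated as a single update.\<close>

definition start_row :: "reg com" where
  "start_row =
     (When (in_A Xu) (Xa ::= Plus (Reg Xa) (Num 1)) ;;
      When (in_B Xu) (Xb ::= Plus (Reg Xb) (Num 1)) ;; Xnb ::= Num 0)"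

lemma step_start_row:
  fixes s :: "reg state"
  defines "D \<equiv> snd s Xdeg" and "k \<equiv> fst s Xk" and "u \<equiv> fst s Xu"
  shows "step M start_row s = ((fst s)(Xa := fst s Xa + of_bool (D u = k - 1),
    Xb := fst s Xb + of_bool (k - 1 < D u), Xnb := 0), snd s)"
  by (auto simp: start_row_def in_A_def in_B_def D_def k_def u_def fun_eq_iff)

definition partition_time :: "nat \<Rightarrow> nat" where
  "partition_time n = 18 + for_time (max_cost start_row + for_time (max_cost inspect_pair) n +
     max_cost (When (Conj (in_A Xu) (Neg (Eq (Reg Xnb) (Num 2)))) (XregA ::= Num 0))) n"

text \<open>The contents \<open>f\<close> of the registers after the first \<open>i\<close> rounds of the outer loop. The conjunct
\<open>D u = k - 1\<close> inside the last cardinality repeats the guard of the counting instruction.\<close>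

definition partition_flags :: "matrix \<Rightarrow> (nat \<Rightarrow> nat) \<Rightarrow> nat \<Rightarrow> nat \<Rightarrow> nat \<Rightarrow> (reg \<Rightarrow> nat) \<Rightarrow> bool" where
  "partition_flags M D n k i f \<longleftrightarrow>
     f Xa = card {u. u < i \<and> D u = k - 1} \<and> f Xb = card {u. u < i \<and> k - 1 < D u} \<and>
     (\<forall>r\<in>pair_flags. f r = of_bool (\<forall>u<i. \<forall>v<n. pair_ok M D k r u v)) \<and>
     f XregA = of_bool (\<forall>u<i. D u = k - 1 \<longrightarrow>
       card {v. v < n \<and> M u v \<and> D u = k - 1 \<and> D v = k - 1} = 2)"

lemma halts_inspect_partition:
  fixes s :: "reg state"
  assumes n: "fst s Xn = n" and k: "fst s Xk = k" and D: "snd s Xdeg = D"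
  shows "halts_within M inspect_partition s (partition_time n)
    (\<lambda>s'. snd s' = snd s \<and> fst s' Xn = n \<and> fst s' Xk = k \<and> fst s' Xfound = fst s Xfound \<and>
      partition_flags M D n k n (fst s'))"
proof -
  let ?I = "\<lambda>i s'. fst s' Xu = i \<and> snd s' = snd s \<and> fst s' Xn = n \<and> fst s' Xk = k \<and>
    fst s' Xfound = fst s Xfound \<and> partition_flags M D n k i (fst s')"
  let ?end = "When (Conj (in_A Xu) (Neg (Eq (Reg Xnb) (Num 2)))) (XregA ::= Num 0)"
  let ?row = "When (in_A Xu) (Xa ::= Plus (Reg Xa) (Num 1)) ;;
    When (in_B Xu) (Xb ::= Plus (Reg Xb) (Num 1)) ;;
    Xnb ::= Num 0 ;; For Xv (Reg Xn) inspect_pair ;; ?end"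
  let ?T = "max_cost start_row + for_time (max_cost inspect_pair) n + max_cost ?end"
  have main: "halts_within M (For Xu (Reg Xn) ?row) t (for_time ?T n) (?I n)"
    if t: "?I 0 ((fst t)(Xu := 0), snd t)" for t
  proof (rule halts_For[where I = ?I, OF t])
    fix i t assume i: "i < n" and I: "?I i t"
    let ?R = "\<lambda>s'. ?I (Suc i) ((fst s')(Xu := Suc i), snd s') \<and> fst s' Xu = i"
    have rest: "halts_within M (For Xv (Reg Xn) inspect_pair ;; ?end) (step M start_row t)
      (for_time (max_cost inspect_pair) n + max_cost ?end) ?R"
    proof -
      define s1 where "s1 = step M start_row t"
      have f1: "fst s1 = (fst t)(Xa := fst t Xa + of_bool (D i = k - 1),
          Xb := fst t Xb + of_bool (k - 1 < D i), Xnb := 0)" "snd s1 = snd s"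
        using I D by (simp_all add: s1_def step_start_row)
      have r1: "fst s1 Xn = n" "fst s1 Xnb = 0" "fst s1 Xk = k" "fst s1 Xu = i" "snd s1 Xdeg = D"
        using I D by (simp_all add: f1)
      show ?thesis
        unfolding s1_def[symmetric]
      proof (rule halts_Seq[OF halts_inspect_row[OF r1(1,2), unfolded r1(3-5)]])
        fix s2 assume s2: "s2 = (\<lambda>r. if r = Xv then n
            else if r = Xnb then card {v. v < n \<and> M i v \<and> D i = k - 1 \<and> D v = k - 1}
            else if \<forall>v<n. pair_ok M D k r i v then fst s1 r else 0, snd s1)"
        have other: "fst s2 r = fst s1 r" if "r \<notin> insert Xv (insert Xnb pair_flags)" for r
          using that by (simp add: s2 pair_ok_other)
        have s2r: "fst s2 Xnb = card {v. v < n \<and> M i v \<and> D i = k - 1 \<and> D v = k - 1}"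
          "snd s2 = snd s" "fst s2 Xu = i" "fst s2 Xk = k" "fst s2 Xn = n"
          "fst s2 Xfound = fst s Xfound" "fst s2 XregA = fst t XregA"
          "fst s2 Xa = fst t Xa + of_bool (D i = k - 1)"
          "fst s2 Xb = fst t Xb + of_bool (k - 1 < D i)"
          using I by (simp_all add: other pair_flags_def f1) (simp_all add: s2 f1)
        have fl: "fst s2 r = of_bool (\<forall>u<Suc i. \<forall>v<n. pair_ok M D k r u v)" if r: "r \<in> pair_flags" for r
        proof -
          have "fst s1 r = fst t r" "r \<noteq> Xv" "r \<noteq> Xnb" using r by (auto simp: f1 pair_flags_def)
          moreover have "fst t r = of_bool (\<forall>u<i. \<forall>v<n. pair_ok M D k r u v)"
            using I r by (simp add: partition_flags_def)
          ultimately show ?thesis unfolding All_less_Suc by (simp add: s2)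
        qed
        show "halts_within M ?end s2 (max_cost ?end) ?R"
        proof (rule halts_loop_free)
          let ?b = "D i = k - 1 \<and> fst s2 Xnb \<noteq> 2"
          have e: "step M ?end s2 = (\<lambda>r. if r = XregA \<and> ?b then 0 else fst s2 r, snd s2)"
            unfolding step_When_clear using D by (simp add: in_A_def s2r)
          have pf: "partition_flags M D n k (Suc i) ((fst (step M ?end s2))(Xu := Suc i))"
          proof -
            have "((fst (step M ?end s2))(Xu := Suc i)) r = fst s2 r" if "r \<in> pair_flags" for r
              using that by (auto simp: e pair_flags_def)
            moreover have "((fst (step M ?end s2))(Xu := Suc i)) XregA =
              of_bool (\<forall>u<Suc i. D u = k - 1 \<longrightarrow>
                card {v. v < n \<and> M u v \<and> D u = k - 1 \<and> D v = k - 1} = 2)"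
              unfolding All_less_Suc e fst_conv using I by (auto simp: s2r partition_flags_def)
            ultimately show ?thesis
              using fl I unfolding partition_flags_def by (simp add: e s2r card_less_Suc)
          qed
          show "?R (step M ?end s2)"
            using pf by (simp add: e s2r)
        qed simp
      qed
    qed
    show "halts_within M ?row t ?T ?R"
    proof (rule halts_mono)
      show "halts_within M ?row t (max_cost (When (in_A Xu) (Xa ::= Plus (Reg Xa) (Num 1))) +
          (max_cost (When (in_B Xu) (Xb ::= Plus (Reg Xb) (Num 1))) + (max_cost (Xnb ::= Num 0 :: reg com) +
          (for_time (max_cost inspect_pair) n + max_cost ?end)))) ?R"
        by (intro halts_loop_free_Seq rest[unfolded start_row_def step.simps(4)]) simp_all
    qed (simp_all add: start_row_def)
  qed auto
  have "halts_within M inspect_partition s (2 + (2 + (2 + (2 + (2 + (2 + (2 + (2 + (2 + for_time ?T n)))))))))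
    (?I n)"
    unfolding inspect_partition_def
    by (rule halts_mono[where T = "max_cost (Xa ::= Num 0 :: reg com) + _"],
        (rule halts_loop_free_Seq, simp)+, rule main)
      (use n k D in \<open>simp_all add: partition_flags_def pair_flags_def\<close>)
  then show ?thesis by (rule halts_mono) (simp_all add: partition_time_def)
qed

lemma card_set_conv_nth:
  assumes "distinct vs"
  shows "card {x \<in> set vs. P x} = card {i. i < length vs \<and> P (vs ! i)}"
proof -
  have "{x \<in> set vs. P x} = (!) vs ` {i. i < length vs \<and> P (vs ! i)}"
    by (auto simp: in_set_conv_nth)
  moreover have "inj_on ((!) vs) {i. i < length vs \<and> P (vs ! i)}"
    using assms by (auto simp: inj_on_def nth_eq_iff_index_eq)
  ultimately show ?thesis by (simp add: card_image)
qed

text \<open>The enumeration \<open>vs\<close> carries cardinalities and bounded quantifiers over vertices to indices.\<close>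

lemma all_answers_yes_iff:
  assumes G: "simple_graph G" and vs: "distinct vs" "set vs = verts G"
  defines "M \<equiv> adjacency_matrix G vs" and "n \<equiv> card (verts G)"
  assumes D: "\<And>u. u < n \<Longrightarrow> D u = card {v. v < n \<and> M u v}"
    and s: "fst s Xk = k" "partition_flags M D n k n (fst s)"
  shows "bval M all_answers_yes s \<longleftrightarrow> NG_check G k"
proof -
  let ?V = "verts G" and ?E = "adj G"
  have len: "length vs = n" using distinct_card[OF vs(1)] vs(2) by (simp add: n_def)
  have Mij: "M i j \<longleftrightarrow> ?E (vs ! i) (vs ! j)" if "i < n" "j < n" for i j
    using that by (simp add: M_def adjacency_matrix_def adj_def len)
  have eq: "vs ! i = vs ! j \<longleftrightarrow> i = j" if "i < n" "j < n" for i j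
    using that vs(1) by (simp add: nth_eq_iff_index_eq len)
  have card: "card {x \<in> ?V. P x} = card {i. i < n \<and> P (vs ! i)}" for P
    using card_set_conv_nth[OF vs(1), of P] by (simp add: vs(2) len)
  have all: "(\<forall>x\<in>?V. P x) \<longleftrightarrow> (\<forall>i<n. P (vs ! i))" for P
    using all_set_conv_all_nth[of vs P] by (simp add: vs(2) len)
  have deg: "vertex_degree G (vs ! i) = D i" if i: "i < n" for i
    unfolding vertex_degree_def card D[OF i]
    by (rule arg_cong[where f = card]) (use Mij[OF i] in \<open>auto simp: adj_def\<close>)
  define A B C where "A = {v \<in> ?V. vertex_degree G v = k - 1}"
    and "B = {v \<in> ?V. vertex_degree G v > k - 1}" and "C = {v \<in> ?V. vertex_degree G v < k - 1}"
  have ballA: "(\<forall>x\<in>A. P x) \<longleftrightarrow> (\<forall>i<n. D i = k - 1 \<longrightarrow> P (vs ! i))"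
    and ballB: "(\<forall>x\<in>B. P x) \<longleftrightarrow> (\<forall>i<n. D i > k - 1 \<longrightarrow> P (vs ! i))"
    and ballC: "(\<forall>x\<in>C. P x) \<longleftrightarrow> (\<forall>i<n. D i < k - 1 \<longrightarrow> P (vs ! i))" for P
    using all[of "\<lambda>x. vertex_degree G x = k - 1 \<longrightarrow> P x"]
      all[of "\<lambda>x. vertex_degree G x > k - 1 \<longrightarrow> P x"]
      all[of "\<lambda>x. vertex_degree G x < k - 1 \<longrightarrow> P x"]
    by (auto simp: A_def B_def C_def deg)
  note flags = s(2)[unfolded partition_flags_def pair_flags_def]
  have "card A = card {u. u < n \<and> D u = k - 1}" "card B = card {u. u < n \<and> k - 1 < D u}"
    unfolding A_def B_def card by (rule arg_cong[where f = card], use deg in auto)+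
  then have cards: "fst s Xa = card A" "fst s Xb = card B" using flags by auto
  have "finite A" unfolding A_def using G by (simp add: simple_graph_def)
  then have ne: "A \<noteq> {} \<longleftrightarrow> 0 < fst s Xa" unfolding cards by auto
  have complA: "fst s XcomplA = 1 \<longleftrightarrow> clique_on ?E A"
  proof -
    have "clique_on ?E A \<longleftrightarrow> (\<forall>u<n. \<forall>v<n. pair_ok M D k XcomplA u v)"
      unfolding clique_on_def ballA ballB ballC by (auto simp: pair_ok_def Mij eq)
    then show ?thesis using flags by simp
  qed
  have complB: "fst s XcomplB = 1 \<longleftrightarrow> clique_on ?E B"
  proof -
    have "clique_on ?E B \<longleftrightarrow> (\<forall>u<n. \<forall>v<n. pair_ok M D k XcomplB u v)"
      unfolding clique_on_def ballA ballB ballC by (auto simp: pair_ok_def Mij eq)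
    then show ?thesis using flags by simp
  qed
  interpret adjacency ?E by (rule adjacency_adj[OF G])
  have adj_neq: "u \<noteq> v" if "?E (vs ! u) (vs ! v)" for u v using that irrefl by metis
  have indepA: "fst s XindepA = 1 \<longleftrightarrow> clique_on (co ?E) A"
  proof -
    have "clique_on (co ?E) A \<longleftrightarrow> (\<forall>u<n. \<forall>v<n. pair_ok M D k XindepA u v)"
      unfolding clique_on_def co_def ballA ballB ballC by (auto simp: pair_ok_def Mij eq dest: adj_neq)
    then show ?thesis using flags by simp
  qed
  have indepC: "fst s XindepC = 1 \<longleftrightarrow> clique_on (co ?E) C"
  proof -
    have "clique_on (co ?E) C \<longleftrightarrow> (\<forall>u<n. \<forall>v<n. pair_ok M D k XindepC u v)"
      unfolding clique_on_def co_def ballA ballB ballC by (auto simp: pair_ok_def Mij eq dest: adj_neq)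
    then show ?thesis using flags by simp
  qed
  have allAB: "fst s XallAB = 1 \<longleftrightarrow> (\<forall>a\<in>A. \<forall>b\<in>B. ?E a b)"
  proof -
    have "(\<forall>a\<in>A. \<forall>b\<in>B. ?E a b) \<longleftrightarrow> (\<forall>u<n. \<forall>v<n. pair_ok M D k XallAB u v)"
      unfolding ballA ballB ballC by (auto simp: pair_ok_def Mij eq) (metis less_irrefl_nat)
    then show ?thesis using flags by simp
  qed
  have noneAC: "fst s XnoneAC = 1 \<longleftrightarrow> (\<forall>a\<in>A. \<forall>c\<in>C. \<not> ?E a c)"
  proof -
    have "(\<forall>a\<in>A. \<forall>c\<in>C. \<not> ?E a c) \<longleftrightarrow> (\<forall>u<n. \<forall>v<n. pair_ok M D k XnoneAC u v)"
      unfolding ballA ballB ballC by (auto simp: pair_ok_def Mij eq)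
    then show ?thesis using flags by simp
  qed
  have five: "fst s XregA = 1 \<and> fst s Xa = 5 \<longleftrightarrow> five_regular ?E A"
  proof -
    have "deg ?E A (vs ! i) = card {v. v < n \<and> M i v \<and> D i = k - 1 \<and> D v = k - 1}"
      if i: "i < n" "D i = k - 1" for i
    proof -
      have "nbrs ?E A (vs ! i) = {x \<in> ?V. ?E (vs ! i) x \<and> vertex_degree G x = k - 1}"
        by (auto simp: nbrs_def A_def)
      then show ?thesis unfolding \<open>nbrs ?E A (vs ! i) = _\<close> card
        by (intro arg_cong[where f = card]) (use i deg Mij[OF i(1)] in auto)
    qed
    then have "(\<forall>a\<in>A. deg ?E A a = 2) \<longleftrightarrow> (\<forall>u<n. D u = k - 1 \<longrightarrow>
        card {v. v < n \<and> M u v \<and> D u = k - 1 \<and> D v = k - 1} = 2)"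
      unfolding ballA by auto
    then show ?thesis using flags unfolding five_regular_def cards by auto
  qed
  have edge: "{u, v} \<in> edges G \<longleftrightarrow> ?E u v" for u v by (simp add: adj_def)
  have b5: "bval M five_cycle_A s \<longleftrightarrow> five_regular ?E A"
    unfolding five[symmetric] by (simp add: five_cycle_A_def)
  have "bval M all_answers_yes s \<longleftrightarrow> A \<noteq> {} \<and>
     (clique_on ?E A \<or> clique_on (co ?E) A \<or> five_regular ?E A) \<and> clique_on ?E B \<and>
     clique_on (co ?E) C \<and> (\<forall>a\<in>A. \<forall>b\<in>B. ?E a b) \<and> (\<forall>a\<in>A. \<forall>c\<in>C. \<not> ?E a c) \<and>
     (clique_on ?E A \<longrightarrow> card A + card B = k) \<and> (clique_on (co ?E) A \<longrightarrow> card B + 1 = k) \<and>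
     (five_regular ?E A \<longrightarrow> card B + 3 = k)"
    unfolding ne complA[symmetric] complB[symmetric] indepA[symmetric] indepC[symmetric]
      allAB[symmetric] noneAC[symmetric] b5[symmetric] cards[symmetric]
    by (simp add: all_answers_yes_def s(1))
  then show ?thesis
    unfolding NG_check_def Let_def A_def[symmetric] B_def[symmetric] C_def[symmetric]
      complete_induced independent_induced five_cycle_induced[OF G] edge .
qed


section \<open>The search for the chromatic number\<close>

abbreviation search_guard :: "reg bexp" where
  "search_guard \<equiv> Conj (Eq (Reg Xfound) (Num 0)) (Neg (Less (Reg Xn) (Reg Xk)))"

abbreviation search_update :: "reg com" where
  "search_update \<equiv> Cond all_answers_yes (Xfound ::= Num 1) (Xk ::= Plus (Reg Xk) (Num 1))"

definition search_time :: "nat \<Rightarrow> nat \<Rightarrow> nat" where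
  "search_time n m = 1 + bcost search_guard +
     m * (1 + bcost search_guard + partition_time n + max_cost search_update)"

lemma halts_search:
  assumes G: "simple_graph G" and vs: "distinct vs" "set vs = verts G"
  defines "M \<equiv> adjacency_matrix G vs" and "n \<equiv> card (verts G)"
  assumes "m = Suc n - k" "k \<le> Suc n" "fst s Xfound = 0" "fst s Xn = n" "fst s Xk = k"
    "\<forall>u<n. snd s Xdeg u = card {v. v < n \<and> M u v}"
  shows "halts_within M (While search_guard (inspect_partition ;; search_update)) s (search_time n m)
    (\<lambda>s'. report s' = find (NG_check G) [k..<Suc n])"
  using assms(6-)
proof (induction m arbitrary: k s)
  case 0
  show ?case
    by (rule halts_mono[OF halts_While_False[where Q = "\<lambda>s'. report s' = find (NG_check G) [k..<Suc n]"]])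
      (use 0 in \<open>auto simp: report_def search_time_def\<close>)
next
  case (Suc m)
  let ?w = "While search_guard (inspect_partition ;; search_update)"
  let ?Q = "\<lambda>s'. report s' = find (NG_check G) [k..<Suc n]"
  have k: "k \<le> n" "m = Suc n - Suc k" using Suc.prems(1) by auto
  have upt: "[k..<Suc n] = k # [Suc k..<Suc n]" using k(1) by (simp add: upt_conv_Cons)
  have body: "halts_within M (inspect_partition ;; search_update) s
    (partition_time n + max_cost search_update)
    (\<lambda>s'. fst s' Xn = n \<and> snd s' = snd s \<and>
       (if NG_check G k then fst s' Xfound = 1 \<and> fst s' Xk = k
        else fst s' Xfound = 0 \<and> fst s' Xk = Suc k))"
  proof (rule halts_Seq[OF halts_inspect_partition[OF Suc.prems(4,5) refl]], elim conjE)
    fix s1 assume s1: "snd s1 = snd s" "fst s1 Xn = n" "fst s1 Xk = k"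
      "fst s1 Xfound = fst s Xfound" "partition_flags M (snd s Xdeg) n k n (fst s1)"
    have "bval M all_answers_yes s1 \<longleftrightarrow> NG_check G k"
      unfolding M_def
      by (rule all_answers_yes_iff[OF G vs, where D = "snd s Xdeg"])
        (use s1 Suc.prems(6) in \<open>simp_all add: M_def n_def\<close>)
    then show "halts_within M search_update s1 (max_cost search_update)
      (\<lambda>s'. fst s' Xn = n \<and> snd s' = snd s \<and>
       (if NG_check G k then fst s' Xfound = 1 \<and> fst s' Xk = k
        else fst s' Xfound = 0 \<and> fst s' Xk = Suc k))"
      by (intro halts_loop_free) (use s1 Suc.prems(3) in auto)
  qed
  have "halts_within M ?w s (1 + bcost search_guard + (partition_time n + max_cost search_update)
    + search_time n m) ?Q"
  proof (rule halts_While_True[OF _ body])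
    show "bval M search_guard s" using Suc.prems k(1) by simp
    fix s1 assume s1: "fst s1 Xn = n \<and> snd s1 = snd s \<and>
       (if NG_check G k then fst s1 Xfound = 1 \<and> fst s1 Xk = k
        else fst s1 Xfound = 0 \<and> fst s1 Xk = Suc k)"
    show "halts_within M ?w s1 (search_time n m) ?Q"
    proof (cases "NG_check G k")
      case True
      show ?thesis
        by (rule halts_mono[OF halts_While_False[where Q = ?Q]])
          (use s1 True in \<open>auto simp: report_def upt search_time_def simp del: upt_Suc\<close>)
    next
      case False
      have "halts_within M ?w s1 (search_time n m) (\<lambda>s'. report s' = find (NG_check G) [Suc k..<Suc n])"
        by (rule Suc.IH) (use s1 False k Suc.prems(6) in auto)
      then show ?thesis using False by (simp only: upt find.simps if_False)
    qed
  qed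
  then show ?case by (rule halts_mono) (simp_all add: search_time_def)
qed

definition program_time :: "nat \<Rightarrow> nat" where
  "program_time n = degree_time n + (4 + search_time n n)"

theorem halts_NG_program:
  assumes G: "simple_graph G" and vs: "distinct vs" "set vs = verts G"
  shows "halts_within (adjacency_matrix G vs) NG_program (initial_state (card (verts G)))
    (program_time (card (verts G))) (\<lambda>s. report s = algorithm_NG G)"
proof -
  let ?n = "card (verts G)" and ?M = "adjacency_matrix G vs"
  show ?thesis
    unfolding NG_program_def program_time_def
  proof (rule halts_Seq[OF halts_compute_degrees[where n = ?n]], goal_cases)
    case 1
    show ?case by (simp add: initial_state_def)
  next
    case (2 s)
    have "halts_within ?M (Xfound ::= Num 0 ;; Xk ::= Num 1 ;;
        While search_guard (inspect_partition ;; search_update)) s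
      (max_cost (Xfound ::= Num 0 :: reg com) + (max_cost (Xk ::= Num 1 :: reg com) + search_time ?n ?n))
      (\<lambda>s'. report s' = algorithm_NG G)"
      unfolding algorithm_NG_def
      by (intro halts_loop_free_Seq halts_search[OF G vs]) (use 2 in simp_all)
    then show ?case by (rule halts_mono) simp_all
  qed
qed

definition polynomial_fun :: "(nat \<Rightarrow> nat) \<Rightarrow> bool" where
  "polynomial_fun f \<longleftrightarrow> (\<exists>p. \<forall>n. f n = poly p n)"

lemma polynomial_fun_intros:
  "polynomial_fun (\<lambda>n. a)"
  "polynomial_fun (\<lambda>n. n)"
  "polynomial_fun f \<Longrightarrow> polynomial_fun g \<Longrightarrow> polynomial_fun (\<lambda>n. f n + g n)"
  "polynomial_fun f \<Longrightarrow> polynomial_fun g \<Longrightarrow> polynomial_fun (\<lambda>n. f n * g n)"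
proof -
  show "polynomial_fun (\<lambda>n. a)" unfolding polynomial_fun_def by (rule exI[of _ "[:a:]"]) simp
  show "polynomial_fun (\<lambda>n. n)" unfolding polynomial_fun_def by (rule exI[of _ "[:0, 1:]"]) simp
  assume "polynomial_fun f" "polynomial_fun g"
  then obtain p q where pq: "\<And>n. f n = poly p n" "\<And>n. g n = poly q n"
    unfolding polynomial_fun_def by blast
  show "polynomial_fun (\<lambda>n. f n + g n)"
    unfolding polynomial_fun_def by (rule exI[of _ "p + q"]) (simp add: pq)
  show "polynomial_fun (\<lambda>n. f n * g n)"
    unfolding polynomial_fun_def by (rule exI[of _ "p * q"]) (simp add: pq)
qed

text \<open>All constants in the bound are costs of fixed pieces of code.\<close>

lemma program_time_polynomial: "polynomial_fun program_time"
  unfolding program_time_def degree_time_def search_time_def partition_time_def for_time_def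
  by (intro polynomial_fun_intros)

theorem theorem3p8:
  shows "\<exists>p :: nat poly. \<forall>(G :: 'a ugraph) vs.
    simple_graph G \<and> distinct vs \<and> set vs = verts G \<longrightarrow>
    (\<exists>t s. run (adjacency_matrix G vs) NG_program (initial_state (card (verts G))) t s \<and>
       t \<le> poly p (card (verts G)) \<and>
       report s = algorithm_NG G \<and>
       report s = (if NG_graph G then Some (chromatic_number G) else None))"
proof -
  obtain p where p: "\<And>n. program_time n = poly p n"
    using program_time_polynomial unfolding polynomial_fun_def by blast
  have "\<exists>t s. run (adjacency_matrix G vs) NG_program (initial_state (card (verts G))) t s \<and>
       t \<le> poly p (card (verts G)) \<and> report s = algorithm_NG G \<and>
       report s = (if NG_graph G then Some (chromatic_number G) else None)"
    if "simple_graph G" "distinct vs" "set vs = verts G" for G :: "'a ugraph" and vs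
    using halts_NG_program[OF that] algorithm_NG_correct[OF that(1)]
    unfolding halts_within_def p by metis
  then show ?thesis by blast
qed

end
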